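(* Let $(A,\varrho_A,[\cdot,\cdot])$ be a skew-symmetric algebroid over a manifold $M$ equipped with a pseudo-Riemannian metric $g\in\Gamma(\mathsf{S}^2A^* )$ in the vector bundle $A$ and an $A$-connection $\nabla$ in $A$. Let $\langle X:Y\rangle=\nabla_XY+\nabla_YX$ be the symmetric bracket of sections induced by $\nabla$. Then for all $X,Y,Z\in\Gamma(A)$, $$g(\langle X:Y\rangle,Z)=g\big(\sharp(\mathcal{L}^a_XY^\flat+\mathcal{L}^a_YX^\flat-d^a(g(X,Y))),Z\big)-g(T^\nabla(X,Z),Y)-g(T^\nabla(Y,Z),X)+2(\nabla g)(Z,X,Y)-(d^sg)(X,Y,Z).$$
   Context: A skew-symmetric algebroid $(A,\varrho_A,[\cdot,\cdot])$ over $M$ is a vector bundle $A\to M$ with a vector bundle homomorphism $\varrho_A:A\to TM$ over the identity (anchor) and an $\mathbb{R}$-bilinear skew-symmetric map $[\cdot,\cdot]:\Gamma(A)\times\Gamma(A)\to\Gamma(A)$ with $[X,fY]=f[X,Y]+(\varrho_A\circ X)(f)\,Y$ for $X,Y\in\Gamma(A)$, $f\in C^\infty(M)$ (no Jacobi identity is assumed, and the anchor need not preserve brackets). An $A$-connection in $A$ is an $\mathbb{R}$-bilinear map $\nabla:\Gamma(A)\times\Gamma(A)\to\Gamma(A)$ with $\nabla_{fX}Y=f\nabla_XY$ and $\nabla_X(fY)=f\nabla_XY+(\varrho_A\circ X)(f)Y$. Its torsion is $T^\nabla(X,Y)=\nabla_XY-\nabla_YX-[X,Y]$. It is extended to covariant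 tensors by $(\nabla_X\zeta)(X_1,\dots,X_k)=(\varrho_A\circ X)(\zeta(X_1,\dots,X_k))-\sum_j\zeta(X_1,\dots,\nabla_XX_j,\dots,X_k)$, and $(\nabla\zeta)(X_1,\dots,X_{k+1})=(\nabla_{X_1}\zeta)(X_2,\dots,X_{k+1})$. The symmetrized covariant derivative of a symmetric tensor $\eta\in\Gamma(\mathsf{S}^kA^* )$ is $(d^s\eta)(X_1,\dots,X_{k+1})=\sum_{j=1}^{k+1}(\nabla_{X_j}\eta)(X_1,\dots,\widehat{X}_j,\dots,X_{k+1})$. A pseudo-Riemannian metric $g$ in $A$ is a nondegenerate section of $\mathsf{S}^2A^*$; $X^\flat=g(X,\cdot)$ and $\sharp:A^*\to A$ is given by $g(\sharp(\omega),X)=\omega(X)$. For $f\in C^\infty(M)$, $(d^af)(X)=(\varrho_A\circ X)(f)$. The (alternating) Lie derivative of $\omega\in\Gamma(A^* )$ is $(\mathcal{L}^a_X\omega)(Y)=(\varrho_A\circ X)(\omega(Y))-\omega([X,Y])$. *)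

theory Defs
  imports "HOL-Analysis.Analysis"
begin

section \<open>Smooth maps between Euclidean spaces\<close>

text \<open>
  Model spaces are finite-dimensional real inner product spaces. The class
  \<open>euclidean_space\<close> is not used for them because it excludes dimension 0.
\<close>

definition finite_dim :: "'a::real_vector set \<Rightarrow> bool" where
  "finite_dim V \<longleftrightarrow> (\<exists>B. finite B \<and> span B = V)"

text \<open>Only meant for open \<open>S\<close>; all directional derivatives are differentiated again.\<close>

fun Ck_on :: "nat \<Rightarrow> ('a::real_normed_vector \<Rightarrow> 'b::real_normed_vector) \<Rightarrow> 'a set \<Rightarrow> bool" where
  "Ck_on 0 f S \<longleftrightarrow> continuous_on S f"
| "Ck_on (Suc k) f S \<longleftrightarrow>
     (\<forall>x\<in>S. f differentiable (at x)) \<and> (\<forall>v. Ck_on k (\<lambda>x. frechet_derivative f (at x) v) S)"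

definition smooth_on :: "('a::real_normed_vector \<Rightarrow> 'b::real_normed_vector) \<Rightarrow> 'a set \<Rightarrow> bool" where
  "smooth_on f S \<longleftrightarrow> (\<forall>k. Ck_on k f S)"


section \<open>Smooth manifolds\<close>

text \<open>
  The manifold is the whole type \<open>'m\<close>, whose topology is Hausdorff and second countable;
  the smooth structure is given by an atlas of pairs \<open>(U, \<phi>)\<close>, where only the values
  of \<open>\<phi>\<close> on \<open>U\<close> matter.
\<close>

type_synonym ('m, 'e) charts = "('m set \<times> ('m \<Rightarrow> 'e)) set"

definition smooth_atlas ::
    "('m::{t2_space,second_countable_topology}, 'e::real_inner) charts \<Rightarrow> bool" where
  "smooth_atlas \<A> \<longleftrightarrow>
     finite_dim (UNIV :: 'e set) \<and>
     (\<Union>(U, \<phi>)\<in>\<A>. U) = UNIV \<and>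
     (\<forall>(U, \<phi>)\<in>\<A>. open U \<and> open (\<phi> ` U) \<and> homeomorphism U (\<phi> ` U) \<phi> (inv_into U \<phi>)) \<and>
     (\<forall>(U, \<phi>)\<in>\<A>. \<forall>(V, \<psi>)\<in>\<A>. smooth_on (\<psi> \<circ> inv_into U \<phi>) (\<phi> ` (U \<inter> V)))"

text \<open>Smoothness of a vector-valued map on an open subset \<open>W\<close> of the manifold.\<close>

definition smooth_map_on ::
    "('m, 'e::real_normed_vector) charts \<Rightarrow> 'm set \<Rightarrow> ('m \<Rightarrow> 'b::real_normed_vector) \<Rightarrow> bool" where
  "smooth_map_on \<A> W h \<longleftrightarrow> (\<forall>(U, \<phi>)\<in>\<A>. smooth_on (h \<circ> inv_into U \<phi>) (\<phi> ` (U \<inter> W)))"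

definition smooth_funs :: "('m, 'e::real_normed_vector) charts \<Rightarrow> ('m \<Rightarrow> real) set" where
  "smooth_funs \<A> = {f. smooth_map_on \<A> UNIV f}"

text \<open>
  Tangent vectors at \<open>p\<close> are derivations at \<open>p\<close> of the algebra of smooth functions; they are
  extended by 0 to non-smooth functions, so that each derivation has a unique representative.
\<close>

definition tangent_space ::
    "('m, 'e::real_normed_vector) charts \<Rightarrow> 'm \<Rightarrow> (('m \<Rightarrow> real) \<Rightarrow> real) set" where
  "tangent_space \<A> p = {D.
     (\<forall>f. f \<notin> smooth_funs \<A> \<longrightarrow> D f = 0) \<and>
     (\<forall>f\<in>smooth_funs \<A>. \<forall>h\<in>smooth_funs \<A>. D (\<lambda>q. f q + h q) = D f + D h) \<and>
     (\<forall>c. \<forall>f\<in>smooth_funs \<A>. D (\<lambda>q. c * f q) = c * D f) \<and>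
     (\<forall>f\<in>smooth_funs \<A>. \<forall>h\<in>smooth_funs \<A>. D (\<lambda>q. f q * h q) = D f * h p + f p * D h)}"


section \<open>Vector bundles\<close>

text \<open>
  The fibres are subspaces of one real vector space \<open>'v\<close>, which carries no topology and is just a
  common home for them: for an arbitrary vector bundle one can take the direct sum of all fibres.
  The smooth structure comes only from the local trivializations \<open>(U, \<tau>)\<close>, in which
  \<open>\<tau> p\<close> is a linear isomorphism from the fibre at \<open>p\<close> onto the model fibre \<open>'f\<close>.
\<close>

record ('m, 'e, 'v, 'f) vbundle =
  atlas :: "('m, 'e) charts"
  fibre :: "'m \<Rightarrow> 'v set"
  trivs :: "('m set \<times> ('m \<Rightarrow> 'v \<Rightarrow> 'f)) set"

definition lin_on :: "'v::real_vector set \<Rightarrow> ('v \<Rightarrow> 'b::real_vector) \<Rightarrow> bool" where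
  "lin_on V h \<longleftrightarrow> (\<forall>u\<in>V. \<forall>w\<in>V. h (u + w) = h u + h w) \<and> (\<forall>c. \<forall>u\<in>V. h (c *\<^sub>R u) = c *\<^sub>R h u)"

abbreviation triv_inv ::
    "('m, 'e, 'v, 'f, 'z) vbundle_scheme \<Rightarrow> ('m \<Rightarrow> 'v \<Rightarrow> 'f) \<Rightarrow> 'm \<Rightarrow> 'f \<Rightarrow> 'v" where
  "triv_inv A \<tau> p \<equiv> inv_into (fibre A p) (\<tau> p)"

definition vector_bundle ::
    "('m::{t2_space,second_countable_topology}, 'e::real_inner, 'v::real_vector, 'f::real_inner, 'z)
       vbundle_scheme \<Rightarrow> bool" where
  "vector_bundle A \<longleftrightarrow>
     smooth_atlas (atlas A) \<and>
     finite_dim (UNIV :: 'f set) \<and>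
     (\<forall>p. subspace (fibre A p)) \<and>
     (\<Union>(U, \<tau>)\<in>trivs A. U) = UNIV \<and>
     (\<forall>(U, \<tau>)\<in>trivs A. open U \<and>
        (\<forall>p\<in>U. lin_on (fibre A p) (\<tau> p) \<and> bij_betw (\<tau> p) (fibre A p) UNIV)) \<and>
     (\<forall>(U, \<tau>)\<in>trivs A. \<forall>(V, \<sigma>)\<in>trivs A. \<forall>w.
        smooth_map_on (atlas A) (U \<inter> V) (\<lambda>p. \<sigma> p (triv_inv A \<tau> p w)))"

definition sections ::
    "('m, 'e::real_normed_vector, 'v, 'f::real_normed_vector, 'z) vbundle_scheme \<Rightarrow> ('m \<Rightarrow> 'v) set" where
  "sections A = {X. (\<forall>p. X p \<in> fibre A p) \<and>
     (\<forall>(U, \<tau>)\<in>trivs A. smooth_map_on (atlas A) U (\<lambda>p. \<tau> p (X p)))}"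


section \<open>Skew-symmetric algebroids\<close>

record ('m, 'e, 'v, 'f) algebroid = "('m, 'e, 'v, 'f) vbundle" +
  anchor :: "'m \<Rightarrow> 'v \<Rightarrow> ('m \<Rightarrow> real) \<Rightarrow> real"
  bracket :: "('m \<Rightarrow> 'v) \<Rightarrow> ('m \<Rightarrow> 'v) \<Rightarrow> ('m \<Rightarrow> 'v)"

text \<open>The function \<open>(\<rho> \<circ> X)(f)\<close>, where \<open>\<rho>\<close> is the anchor.\<close>

definition anchor_act ::
    "('m, 'e, 'v, 'f, 'z) algebroid_scheme \<Rightarrow> ('m \<Rightarrow> 'v) \<Rightarrow> ('m \<Rightarrow> real) \<Rightarrow> 'm \<Rightarrow> real" where
  "anchor_act A X f = (\<lambda>p. anchor A p (X p) f)"

text \<open>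
  Vector bundle homomorphisms to the tangent bundle over the identity: fibrewise linear, and
  taking smooth sections to smooth vector fields, i.e. to those preserving smooth functions.
\<close>

definition anchor_hom ::
    "('m, 'e::real_normed_vector, 'v::real_vector, 'f::real_normed_vector, 'z) algebroid_scheme \<Rightarrow> bool" where
  "anchor_hom A \<longleftrightarrow>
     (\<forall>p. \<forall>v\<in>fibre A p. anchor A p v \<in> tangent_space (atlas A) p) \<and>
     (\<forall>p f. lin_on (fibre A p) (\<lambda>v. anchor A p v f)) \<and>
     (\<forall>X\<in>sections A. \<forall>f\<in>smooth_funs (atlas A). anchor_act A X f \<in> smooth_funs (atlas A))"

definition R_bilinear_on_sections ::
    "('m, 'e::real_normed_vector, 'v::real_vector, 'f::real_normed_vector, 'z) vbundle_scheme \<Rightarrow>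
     (('m \<Rightarrow> 'v) \<Rightarrow> ('m \<Rightarrow> 'v) \<Rightarrow> ('m \<Rightarrow> 'v)) \<Rightarrow> bool" where
  "R_bilinear_on_sections A B \<longleftrightarrow>
     (\<forall>X\<in>sections A. \<forall>Y\<in>sections A. B X Y \<in> sections A) \<and>
     (\<forall>X\<in>sections A. \<forall>Y\<in>sections A. \<forall>Z\<in>sections A.
        B (\<lambda>p. X p + Y p) Z = (\<lambda>p. B X Z p + B Y Z p) \<and>
        B Z (\<lambda>p. X p + Y p) = (\<lambda>p. B Z X p + B Z Y p)) \<and>
     (\<forall>c. \<forall>X\<in>sections A. \<forall>Y\<in>sections A.
        B (\<lambda>p. c *\<^sub>R X p) Y = (\<lambda>p. c *\<^sub>R B X Y p) \<and>
        B X (\<lambda>p. c *\<^sub>R Y p) = (\<lambda>p. c *\<^sub>R B X Y p))"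

definition skew_symmetric_algebroid ::
    "('m::{t2_space,second_countable_topology}, 'e::real_inner, 'v::real_vector, 'f::real_inner, 'z)
       algebroid_scheme \<Rightarrow> bool" where
  "skew_symmetric_algebroid A \<longleftrightarrow>
     vector_bundle A \<and> anchor_hom A \<and>
     R_bilinear_on_sections A (bracket A) \<and>
     (\<forall>X\<in>sections A. \<forall>Y\<in>sections A. bracket A X Y = (\<lambda>p. - bracket A Y X p)) \<and>
     (\<forall>X\<in>sections A. \<forall>Y\<in>sections A. \<forall>f\<in>smooth_funs (atlas A).
        bracket A X (\<lambda>p. f p *\<^sub>R Y p) =
          (\<lambda>p. f p *\<^sub>R bracket A X Y p + anchor_act A X f p *\<^sub>R Y p))"

definition connection ::
    "('m, 'e::real_normed_vector, 'v::real_vector, 'f::real_normed_vector, 'z) algebroid_scheme \<Rightarrow>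
     (('m \<Rightarrow> 'v) \<Rightarrow> ('m \<Rightarrow> 'v) \<Rightarrow> ('m \<Rightarrow> 'v)) \<Rightarrow> bool" where
  "connection A nab \<longleftrightarrow>
     R_bilinear_on_sections A nab \<and>
     (\<forall>X\<in>sections A. \<forall>Y\<in>sections A. \<forall>f\<in>smooth_funs (atlas A).
        nab (\<lambda>p. f p *\<^sub>R X p) Y = (\<lambda>p. f p *\<^sub>R nab X Y p) \<and>
        nab X (\<lambda>p. f p *\<^sub>R Y p) = (\<lambda>p. f p *\<^sub>R nab X Y p + anchor_act A X f p *\<^sub>R Y p))"

definition sym_bracket ::
    "(('m \<Rightarrow> 'v) \<Rightarrow> ('m \<Rightarrow> 'v) \<Rightarrow> ('m \<Rightarrow> 'v::real_vector)) \<Rightarrow> ('m \<Rightarrow> 'v) \<Rightarrow> ('m \<Rightarrow> 'v) \<Rightarrow> 'm \<Rightarrow> 'v" where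
  "sym_bracket nab X Y = (\<lambda>p. nab X Y p + nab Y X p)"

definition torsion ::
    "('m, 'e, 'v::real_vector, 'f, 'z) algebroid_scheme \<Rightarrow>
     (('m \<Rightarrow> 'v) \<Rightarrow> ('m \<Rightarrow> 'v) \<Rightarrow> ('m \<Rightarrow> 'v)) \<Rightarrow> ('m \<Rightarrow> 'v) \<Rightarrow> ('m \<Rightarrow> 'v) \<Rightarrow> 'm \<Rightarrow> 'v" where
  "torsion A nab X Y = (\<lambda>p. nab X Y p - nab Y X p - bracket A X Y p)"


section \<open>Covariant tensors\<close>

text \<open>
  A covariant \<open>k\<close>-tensor is represented by its action \<open>\<zeta> [X\<^sub>1, \<dots>, X\<^sub>k]\<close> on lists of \<open>k\<close> sections,
  with values in functions on the manifold.
\<close>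

type_synonym ('m, 'v) cotensor = "('m \<Rightarrow> 'v) list \<Rightarrow> 'm \<Rightarrow> real"

definition cov_deriv ::
    "('m, 'e, 'v, 'f, 'z) algebroid_scheme \<Rightarrow> (('m \<Rightarrow> 'v) \<Rightarrow> ('m \<Rightarrow> 'v) \<Rightarrow> ('m \<Rightarrow> 'v)) \<Rightarrow>
     ('m \<Rightarrow> 'v) \<Rightarrow> ('m, 'v) cotensor \<Rightarrow> ('m, 'v) cotensor" where
  "cov_deriv A nab X \<zeta> Xs =
     (\<lambda>p. anchor_act A X (\<zeta> Xs) p - (\<Sum>j<length Xs. \<zeta> (Xs[j := nab X (Xs ! j)]) p))"

text \<open>The \<open>(k+1)\<close>-tensor \<open>\<nabla>\<zeta>\<close>; the direction of differentiation is the first argument.\<close>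

definition cov_diff ::
    "('m, 'e, 'v, 'f, 'z) algebroid_scheme \<Rightarrow> (('m \<Rightarrow> 'v) \<Rightarrow> ('m \<Rightarrow> 'v) \<Rightarrow> ('m \<Rightarrow> 'v)) \<Rightarrow>
     ('m, 'v) cotensor \<Rightarrow> ('m, 'v) cotensor" where
  "cov_diff A nab \<zeta> Xs = cov_deriv A nab (hd Xs) \<zeta> (tl Xs)"

definition sym_cov_diff ::
    "('m, 'e, 'v, 'f, 'z) algebroid_scheme \<Rightarrow> (('m \<Rightarrow> 'v) \<Rightarrow> ('m \<Rightarrow> 'v) \<Rightarrow> ('m \<Rightarrow> 'v)) \<Rightarrow>
     ('m, 'v) cotensor \<Rightarrow> ('m, 'v) cotensor" where
  "sym_cov_diff A nab \<eta> Xs =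
     (\<lambda>p. \<Sum>j<length Xs. cov_deriv A nab (Xs ! j) \<eta> (take j Xs @ drop (Suc j) Xs) p)"


section \<open>Pseudo-Riemannian metrics and one-forms\<close>

text \<open>Only the values of \<open>g p\<close> on the fibre at \<open>p\<close> matter.\<close>

definition pseudo_riemannian_metric ::
    "('m, 'e::real_normed_vector, 'v::real_vector, 'f, 'z) vbundle_scheme \<Rightarrow>
     ('m \<Rightarrow> 'v \<Rightarrow> 'v \<Rightarrow> real) \<Rightarrow> bool" where
  "pseudo_riemannian_metric A g \<longleftrightarrow>
     (\<forall>p. \<forall>v\<in>fibre A p. lin_on (fibre A p) (g p v)) \<and>
     (\<forall>p. \<forall>v\<in>fibre A p. \<forall>w\<in>fibre A p. g p v w = g p w v) \<and>
     (\<forall>(U, \<tau>)\<in>trivs A. \<forall>a b.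
        smooth_map_on (atlas A) U (\<lambda>p. g p (triv_inv A \<tau> p a) (triv_inv A \<tau> p b))) \<and>
     (\<forall>p. \<forall>v\<in>fibre A p. (\<forall>w\<in>fibre A p. g p v w = 0) \<longrightarrow> v = 0)"

definition metric_tensor :: "('m \<Rightarrow> 'v \<Rightarrow> 'v \<Rightarrow> real) \<Rightarrow> ('m, 'v) cotensor" where
  "metric_tensor g Xs = (\<lambda>p. g p ((Xs ! 0) p) ((Xs ! 1) p))"

text \<open>A one-form is represented by its action on sections, with values in functions.\<close>

type_synonym ('m, 'v) one_form = "('m \<Rightarrow> 'v) \<Rightarrow> 'm \<Rightarrow> real"

definition flat :: "('m \<Rightarrow> 'v \<Rightarrow> 'v \<Rightarrow> real) \<Rightarrow> ('m \<Rightarrow> 'v) \<Rightarrow> ('m, 'v) one_form" where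
  "flat g X = (\<lambda>Y p. g p (X p) (Y p))"

text \<open>
  The value at \<open>p\<close> of the section \<open>\<sharp>(\<omega>)\<close>: the element of the fibre at \<open>p\<close>
  with \<open>g(\<sharp>(\<omega>), X) = \<omega>(X)\<close> at \<open>p\<close> for all sections \<open>X\<close>.
\<close>

definition sharp ::
    "('m, 'e::real_normed_vector, 'v, 'f::real_normed_vector, 'z) vbundle_scheme \<Rightarrow>
     ('m \<Rightarrow> 'v \<Rightarrow> 'v \<Rightarrow> real) \<Rightarrow> ('m, 'v) one_form \<Rightarrow> 'm \<Rightarrow> 'v" where
  "sharp A g \<omega> = (\<lambda>p. THE v. v \<in> fibre A p \<and> (\<forall>X\<in>sections A. g p v (X p) = \<omega> X p))"

definition d_alt ::
    "('m, 'e, 'v, 'f, 'z) algebroid_scheme \<Rightarrow> ('m \<Rightarrow> real) \<Rightarrow> ('m, 'v) one_form" where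
  "d_alt A f = (\<lambda>X. anchor_act A X f)"

definition lie_alt ::
    "('m, 'e, 'v, 'f, 'z) algebroid_scheme \<Rightarrow> ('m \<Rightarrow> 'v) \<Rightarrow> ('m, 'v) one_form \<Rightarrow> ('m, 'v) one_form" where
  "lie_alt A X \<omega> = (\<lambda>Y p. anchor_act A X (\<omega> Y) p - \<omega> (bracket A X Y) p)"

end

theory Submission
  imports Defs
begin

text \<open>
  Once \<open>g(\<sharp>(\<omega>), Z)\<close> is replaced by \<open>\<omega>(Z)\<close>, for
  \<open>\<omega> = \<L>\<^sub>X Y\<^sup>\<flat> + \<L>\<^sub>Y X\<^sup>\<flat> - d(g(X,Y))\<close>, the formula is a pointwise identity between real
  numbers. Expanding the torsions and the covariant derivatives of \<open>g\<close>, the derivatives of the functions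
  \<open>g(Y,Z)\<close>, \<open>g(X,Z)\<close>, \<open>g(X,Y)\<close> cancel, and so do the terms with \<open>[X,Z]\<close>, \<open>[Y,Z]\<close> and with the
  covariant derivatives that involve \<open>Z\<close>. There remain \<open>g(\<nabla>\<^sub>X Y,Z) + g(\<nabla>\<^sub>Y X,Z)\<close>.

  The substance is therefore in \<open>metric_sharp\<close>: the vector of the fibre described by \<open>sharp\<close> exists and
  is unique. Uniqueness needs a global section through every vector of a fibre (\<open>section_through\<close>).
  Existence needs that \<open>\<omega>(W)\<close> at \<open>p\<close> depends only on \<open>W p\<close> (\<open>smooth_one_form_pointwise\<close>), so that \<open>\<omega>\<close> is a
  linear functional on the fibre, and then linear algebra of nondegenerate forms
  (\<open>nondegenerate_form_represents\<close>). The dependence on \<open>W p\<close> alone follows from function-linearity of \<open>\<omega>\<close>,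
  which for the Lie derivatives is the cancellation of two Leibniz terms (\<open>smooth_one_form_lie_alt\<close>).

  Both facts about sections rest on bump functions (\<open>bump_function\<close>), by which local frames and
  coordinates are extended to the whole manifold. They are built from \<open>exp (- 1 / t)\<close>, the smoothness of
  squared norms and coordinate changes, and the compactness of closed balls in the model space.
\<close>

section \<open>Calculus of smooth maps\<close>

lemma Ck_on_subset: "Ck_on k f S \<Longrightarrow> T \<subseteq> S \<Longrightarrow> Ck_on k f T"
  by (induction k arbitrary: f) (auto intro: continuous_on_subset)

lemma frechet_derivative_cong_open:
  assumes "open S" "x \<in> S" "\<And>y. y \<in> S \<Longrightarrow> f y = g y"
  shows "frechet_derivative f (at x) = frechet_derivative g (at x)"
proof -
  have "(f has_derivative D) (at x) \<longleftrightarrow> (g has_derivative D) (at x)" for D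
    using has_derivative_transform_within_open[of f D x UNIV S g]
      has_derivative_transform_within_open[of g D x UNIV S f] assms by auto
  then show ?thesis by (simp add: frechet_derivative_def)
qed

lemma differentiable_cong_open:
  assumes "open S" "x \<in> S" "\<And>y. y \<in> S \<Longrightarrow> f y = g y" "f differentiable (at x)"
  shows "g differentiable (at x)"
  using has_derivative_transform_within_open[of f _ x UNIV S g] assms
  unfolding differentiable_def by blast

text \<open>The derivatives at a point of an open set depend only on the germ there, so values off \<open>S\<close>,
  such as those of \<open>inv_into U \<phi>\<close> outside the range of a chart, are irrelevant.\<close>
lemma Ck_on_cong:
  assumes "open S"
  shows "Ck_on k f S \<Longrightarrow> (\<And>x. x \<in> S \<Longrightarrow> f x = g x) \<Longrightarrow> Ck_on k g S"
proof (induction k arbitrary: f g)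
  case 0
  then show ?case using continuous_on_cong by fastforce
next
  case (Suc k)
  have "Ck_on k (\<lambda>x. frechet_derivative g (at x) v) S" for v
  proof (rule Suc.IH)
    show "Ck_on k (\<lambda>x. frechet_derivative f (at x) v) S" using Suc.prems by simp
    show "frechet_derivative f (at x) v = frechet_derivative g (at x) v" if "x \<in> S" for x
      using frechet_derivative_cong_open[OF assms that Suc.prems(2)] by simp
  qed
  then show ?case
    using Suc.prems differentiable_cong_open[OF assms] by (metis Ck_on.simps(2))
qed

lemma Ck_on_UN:
  assumes "\<And>i. i \<in> I \<Longrightarrow> open (S i)"
  shows "(\<And>i. i \<in> I \<Longrightarrow> Ck_on k f (S i)) \<Longrightarrow> Ck_on k f (\<Union>i\<in>I. S i)"
  by (induction k arbitrary: f) (auto intro: continuous_on_open_UN assms)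

lemma Ck_on_Suc_imp: "Ck_on (Suc k) f S \<Longrightarrow> Ck_on k f S"
proof (induction k arbitrary: f)
  case 0
  then show ?case
    by (auto intro!: continuous_at_imp_continuous_on differentiable_imp_continuous_within)
next
  case (Suc k)
  then show ?case by (metis Ck_on.simps(2))
qed

text \<open>\<open>Ck_on\<close> is phrased with \<open>frechet_derivative\<close>; by uniqueness of derivatives on open sets, any
  explicit formula \<open>D\<close> for the derivative may be used in its place.\<close>
lemma Ck_on_SucI:
  assumes "open S" "\<And>x. x \<in> S \<Longrightarrow> (f has_derivative D x) (at x)"
    "\<And>v. Ck_on k (\<lambda>x. D x v) S"
  shows "Ck_on (Suc k) f S"
proof -
  have "Ck_on k (\<lambda>x. frechet_derivative f (at x) v) S" for v
    by (rule Ck_on_cong[OF assms(1) assms(3)[of v]]) (metis assms(2) frechet_derivative_at)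
  then show ?thesis using assms(2) by (auto simp: differentiable_def)
qed

lemma Ck_on_Suc_has_derivative:
  "Ck_on (Suc k) f S \<Longrightarrow> x \<in> S \<Longrightarrow> (f has_derivative frechet_derivative f (at x)) (at x)"
  by (simp add: frechet_derivative_works[symmetric])

lemma Ck_on_const: "open S \<Longrightarrow> Ck_on k (\<lambda>x. c) S"
proof (induction k arbitrary: c)
  case (Suc k)
  then show ?case by (intro Ck_on_SucI[where D = "\<lambda>x v. 0"]) auto
qed auto

lemma Ck_on_add:
  assumes "open S"
  shows "Ck_on k f S \<Longrightarrow> Ck_on k g S \<Longrightarrow> Ck_on k (\<lambda>x. f x + g x) S"
proof (induction k arbitrary: f g)
  case 0
  then show ?case by (auto intro: continuous_on_add)
next
  case (Suc k)
  show ?case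
  proof (rule Ck_on_SucI[OF assms])
    show "((\<lambda>x. f x + g x) has_derivative
        (\<lambda>v. frechet_derivative f (at x) v + frechet_derivative g (at x) v)) (at x)" if "x \<in> S" for x
      using Suc.prems that by (intro has_derivative_add Ck_on_Suc_has_derivative)
  qed (use Suc in auto)
qed

text \<open>Products of functions, scalar multiples and inner products are all treated by this one lemma.
  By the product rule the derivative is a sum of two terms of the same form, one order lower.\<close>
lemma Ck_on_bilinear:
  assumes "open S" "bounded_bilinear P"
  shows "Ck_on k f S \<Longrightarrow> Ck_on k g S \<Longrightarrow> Ck_on k (\<lambda>x. P (f x) (g x)) S"
proof (induction k arbitrary: f g)
  case 0
  then show ?case by (auto intro: bounded_bilinear.continuous_on[OF assms(2)])
next
  case (Suc k)
  note lower = Ck_on_Suc_imp[OF Suc.prems(1)] Ck_on_Suc_imp[OF Suc.prems(2)]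
  show ?case
  proof (rule Ck_on_SucI[OF assms(1)])
    show "((\<lambda>x. P (f x) (g x)) has_derivative
        (\<lambda>v. P (f x) (frechet_derivative g (at x) v) + P (frechet_derivative f (at x) v) (g x))) (at x)"
      if "x \<in> S" for x
      using Suc.prems that by (intro bounded_bilinear.FDERIV[OF assms(2)] Ck_on_Suc_has_derivative)
    show "Ck_on k (\<lambda>x. P (f x) (frechet_derivative g (at x) v) + P (frechet_derivative f (at x) v) (g x)) S" for v
      using Suc.prems lower by (intro Ck_on_add[OF assms(1)] Suc.IH) auto
  qed
qed

text \<open>The outer function is given together with all its derivatives: the derivative of
  \<open>H n \<circ> u\<close> is the product of \<open>H (Suc n) \<circ> u\<close> and a derivative of \<open>u\<close>, so the
  induction has to move along the sequence \<open>H\<close>.\<close>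
lemma Ck_on_compose_real:
  fixes H :: "nat \<Rightarrow> real \<Rightarrow> real"
  assumes "open S" and H: "\<And>n t. (H n has_real_derivative H (Suc n) t) (at t)"
  shows "Ck_on k u S \<Longrightarrow> Ck_on k (\<lambda>x. H n (u x)) S"
proof (induction k arbitrary: n)
  case 0
  have "continuous_on UNIV (H n)"
    by (meson H DERIV_continuous_on has_field_derivative_at_within)
  then show ?case using 0 by (auto intro: continuous_on_compose2)
next
  case (Suc k)
  show ?case
  proof (rule Ck_on_SucI[OF assms(1)])
    show "((\<lambda>x. H n (u x)) has_derivative (\<lambda>v. H (Suc n) (u x) * frechet_derivative u (at x) v)) (at x)"
      if "x \<in> S" for x
      using has_derivative_compose[OF Ck_on_Suc_has_derivative[OF Suc.prems that]
          H[of n "u x", unfolded has_field_derivative_def]] .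
    show "Ck_on k (\<lambda>x. H (Suc n) (u x) * frechet_derivative u (at x) v) S" for v
      using Suc.IH[OF Ck_on_Suc_imp[OF Suc.prems]] Suc.prems
      by (intro Ck_on_bilinear[OF assms(1) bounded_bilinear_mult]) simp_all
  qed
qed

text \<open>For \<open>P = 1\<close> this is the classical smooth function that vanishes on the closed negative half
  line and is positive elsewhere. The polynomial factor makes the family closed under differentiation.\<close>
definition flat_exp :: "real poly \<Rightarrow> real \<Rightarrow> real" where
  "flat_exp P t = (if t > 0 then poly P (1 / t) * exp (- (1 / t)) else 0)"

lemma poly_times_exp_minus_tendsto_0:
  fixes P :: "real poly"
  shows "((\<lambda>y. poly P y * exp (- y)) \<longlongrightarrow> 0) at_top"
proof -
  have "((\<lambda>y. \<Sum>i\<le>degree P. coeff P i * (y ^ i / exp y)) \<longlongrightarrow> (\<Sum>i\<le>degree P. coeff P i * 0)) at_top"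
    by (intro tendsto_intros tendsto_power_div_exp_0)
  then show ?thesis
    by (simp add: poly_altdef exp_minus sum_distrib_right divide_inverse mult.assoc)
qed

text \<open>Substituting \<open>y = 1/t\<close> turns the difference quotient at 0 into a polynomial times
  \<open>exp (- y)\<close> as \<open>y\<close> tends to infinity.\<close>
lemma flat_exp_over_t_tendsto_0: "((\<lambda>t. flat_exp P t / t) \<longlongrightarrow> 0) (at 0)"
proof -
  have "((\<lambda>t. poly (pCons 0 P) (inverse t) * exp (- inverse t)) \<longlongrightarrow> 0) (at_right 0)"
    by (rule filterlim_compose[OF poly_times_exp_minus_tendsto_0 filterlim_inverse_at_top_right])
  then have "((\<lambda>t. flat_exp P t / t) \<longlongrightarrow> 0) (at_right 0)"
    by (rule Lim_transform_eventually)
       (auto simp: eventually_at_filter flat_exp_def field_simps)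
  moreover have "((\<lambda>t. flat_exp P t / t) \<longlongrightarrow> 0) (at_left 0)"
    by (rule Lim_transform_eventually[OF tendsto_const])
       (auto simp: eventually_at_filter flat_exp_def)
  ultimately show ?thesis by (simp add: filterlim_split_at)
qed

lemma flat_exp_deriv:
  "(flat_exp P has_real_derivative flat_exp ([:0, 0, 1:] * (P - pderiv P)) t) (at t)"
proof (cases "t = 0")
  case True
  then show ?thesis
    using flat_exp_over_t_tendsto_0[of P] by (simp add: has_field_derivative_iff flat_exp_def)
next
  case False
  show ?thesis
  proof (cases "t > 0")
    case True
    have "((\<lambda>t. poly P (1 / t) * exp (- (1 / t))) has_real_derivative
        flat_exp ([:0, 0, 1:] * (P - pderiv P)) t) (at t)"
      using True
      by (auto intro!: derivative_eq_intros poly_DERIV[THEN DERIV_chain2] simp: flat_exp_def)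
        (simp add: field_simps power2_eq_square)
    then show ?thesis
      by (rule has_field_derivative_transform_within_open[where S = "{0<..}"])
        (use True in \<open>auto simp: flat_exp_def\<close>)
  next
    case neg: False
    with False have "t < 0" by simp
    show ?thesis
      by (rule has_field_derivative_transform_within_open[where S = "{..<0}" and f = "\<lambda>_. 0"])
        (use \<open>t < 0\<close> in \<open>auto simp: flat_exp_def\<close>)
  qed
qed

lemma smooth_on_flat_exp_compose:
  assumes "open S" "smooth_on u S"
  shows "smooth_on (\<lambda>x. flat_exp 1 (u x)) S"
proof -
  define H where "H n = flat_exp (((\<lambda>P. [:0, 0, 1:] * (P - pderiv P)) ^^ n) 1)" for n
  have "(H n has_real_derivative H (Suc n) t) (at t)" for n t
    unfolding H_def funpow.simps o_apply by (rule flat_exp_deriv)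
  then have "Ck_on k (\<lambda>x. H 0 (u x)) S" for k
    using assms by (intro Ck_on_compose_real[where H = H]) (auto simp: smooth_on_def)
  moreover have "H 0 = flat_exp 1" by (simp add: H_def)
  ultimately show ?thesis by (simp add: smooth_on_def)
qed


section \<open>Finite-dimensional inner product spaces\<close>

text \<open>An orthogonal spanning set (possibly containing 0, where division by zero gives the right value)
  yields coordinates \<open>x \<bullet> c\<close>, which depend smoothly on \<open>x\<close> because the inner product is bilinear.\<close>
lemma finite_dim_expansion:
  assumes "finite_dim (UNIV :: 'a::real_inner set)"
  obtains C :: "'a::real_inner set" and d :: "'a::real_inner \<Rightarrow> 'a"
  where "finite C" "\<And>x. x = (\<Sum>c\<in>C. (x \<bullet> c) *\<^sub>R d c)"
proof -
  from assms obtain B :: "'a set" where "finite B" "span B = UNIV" by (auto simp: finite_dim_def)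
  then obtain C :: "'a set" where C: "finite C" "span C = UNIV" "pairwise orthogonal C"
    using basis_orthogonal by metis
  have "x = (\<Sum>c\<in>C. (x \<bullet> c) *\<^sub>R (c /\<^sub>R (c \<bullet> c)))" for x
  proof -
    have "x \<in> span C" using C(2) by simp
    then obtain u where u: "x = (\<Sum>c\<in>C. u c *\<^sub>R c)"
      unfolding span_finite[OF C(1)] by blast
    have coeff: "x \<bullet> c = u c * (c \<bullet> c)" if "c \<in> C" for c
    proof -
      have "x \<bullet> c = (\<Sum>b\<in>C. u b * (b \<bullet> c))" by (simp add: u inner_sum_left)
      also have "\<dots> = (\<Sum>b\<in>C. if b = c then u c * (c \<bullet> c) else 0)"
        using C(3) that by (intro sum.cong refl) (auto simp: pairwise_def orthogonal_def)
      finally show ?thesis using C(1) that by simp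
    qed
    have "u c *\<^sub>R c = (x \<bullet> c) *\<^sub>R (c /\<^sub>R (c \<bullet> c))" if "c \<in> C" for c
      using coeff[OF that] by (cases "c = 0") simp_all
    then have "(\<Sum>c\<in>C. u c *\<^sub>R c) = (\<Sum>c\<in>C. (x \<bullet> c) *\<^sub>R (c /\<^sub>R (c \<bullet> c)))"
      by (rule sum.cong[OF refl])
    with u show ?thesis by (rule trans)
  qed
  with C(1) show ?thesis by (rule that)
qed

lemma compact_bounded_combinations:
  fixes d :: "'c \<Rightarrow> 'a::real_normed_vector"
  assumes "finite C"
  shows "compact {\<Sum>c\<in>C. t c *\<^sub>R d c | t. \<forall>c\<in>C. \<bar>t c\<bar> \<le> K c}"
  using assms
proof (induction C)
  case empty
  then show ?case by simp
next
  case (insert a C)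
  have eq: "{\<Sum>c\<in>insert a C. t c *\<^sub>R d c | t. \<forall>c\<in>insert a C. \<bar>t c\<bar> \<le> K c}
      = {x + y | x y. x \<in> (\<lambda>s. s *\<^sub>R d a) ` {- K a..K a} \<and>
          y \<in> {\<Sum>c\<in>C. t c *\<^sub>R d c | t. \<forall>c\<in>C. \<bar>t c\<bar> \<le> K c}}" (is "?L = ?R")
  proof
    show "?L \<subseteq> ?R"
    proof
      fix z assume "z \<in> ?L"
      then obtain t where t: "\<forall>c\<in>insert a C. \<bar>t c\<bar> \<le> K c"
        and z: "z = t a *\<^sub>R d a + (\<Sum>c\<in>C. t c *\<^sub>R d c)" using insert.hyps by auto
      have "t a \<in> {- K a..K a}" using t by (auto simp: abs_le_iff)
      then show "z \<in> ?R" using t z by blast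
    qed
    show "?R \<subseteq> ?L"
    proof
      fix z assume "z \<in> ?R"
      then obtain s t where "s \<in> {- K a..K a}" and t: "\<forall>c\<in>C. \<bar>t c\<bar> \<le> K c"
        and z: "z = s *\<^sub>R d a + (\<Sum>c\<in>C. t c *\<^sub>R d c)" by blast
      then have s: "\<bar>s\<bar> \<le> K a" by auto
      have "(\<Sum>c\<in>C. (t(a := s)) c *\<^sub>R d c) = (\<Sum>c\<in>C. t c *\<^sub>R d c)"
        using insert.hyps by (intro sum.cong) auto
      then show "z \<in> ?L" using insert.hyps s t z by (intro CollectI exI[of _ "t(a := s)"]) auto
    qed
  qed
  have "compact ((\<lambda>s. s *\<^sub>R d a) ` {- K a..K a})"
    by (intro compact_continuous_image continuous_intros) auto
  then show ?case unfolding eq using insert.IH by (rule compact_sums)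
qed

text \<open>The coordinates of the points of a ball are bounded, so the ball is a closed subset of the
  compact image of a box.\<close>
lemma compact_cball_finite_dim:
  fixes x :: "'a::real_inner"
  assumes "finite_dim (UNIV :: 'a set)"
  shows "compact (cball x r)"
proof -
  obtain C :: "'a set" and d where C: "finite C" "\<And>y. y = (\<Sum>c\<in>C. (y \<bullet> c) *\<^sub>R d c)"
    by (rule finite_dim_expansion[OF assms]) (rule that)
  define K where "K c = (norm x + r) * norm c" for c :: 'a
  have "cball x r \<subseteq> {\<Sum>c\<in>C. t c *\<^sub>R d c | t. \<forall>c\<in>C. \<bar>t c\<bar> \<le> K c}"
  proof
    fix y assume "y \<in> cball x r"
    then have "norm y \<le> norm x + r"
      using norm_triangle_sub[of y x] by (simp add: dist_norm norm_minus_commute)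
    then have "norm y * norm c \<le> K c" for c
      unfolding K_def by (rule mult_right_mono) simp
    then have bound: "\<bar>y \<bullet> c\<bar> \<le> K c" for c
      by (rule order_trans[OF Cauchy_Schwarz_ineq2])
    show "y \<in> {\<Sum>c\<in>C. t c *\<^sub>R d c | t. \<forall>c\<in>C. \<bar>t c\<bar> \<le> K c}"
      unfolding mem_Collect_eq by (rule exI[of _ "\<lambda>c. y \<bullet> c"]) (rule conjI[OF C(2)], rule ballI, rule bound)
  qed
  from inf.absorb2[OF this] show ?thesis
    using compact_Int_closed[OF compact_bounded_combinations[OF C(1)] closed_cball] by (rule subst)
qed

text \<open>Algebraic Riesz representation: \<open>a \<mapsto> (G a c)\<close>, with \<open>c\<close> running through a basis, is an injective
  linear map between spaces of equal finite dimension, hence onto.\<close>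
lemma nondegenerate_form_represents:
  fixes G :: "'a::real_vector \<Rightarrow> 'a \<Rightarrow> real"
  assumes "finite_dim (UNIV :: 'a set)"
    and lin_left: "\<And>b. linear (\<lambda>a. G a b)" and lin_right: "\<And>a. linear (G a)"
    and nondeg: "\<And>a. \<forall>b. G a b = 0 \<Longrightarrow> a = 0"
    and "linear L"
  obtains a where "G a = L"
proof -
  from assms(1) obtain B0 :: "'a set" where B0: "finite B0" "span B0 = UNIV"
    by (auto simp: finite_dim_def)
  obtain B where B: "B \<subseteq> B0" "independent B" "B0 \<subseteq> span B"
    using maximal_independent_subset by blast
  have fin: "finite B" using B(1) B0(1) finite_subset by blast
  have sp: "span B = UNIV" using B(3) B0(2) by (metis span_mono span_span top.extremum_uniqueI)
  interpret V: finite_dimensional_vector_space_pair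
      "scaleR :: real \<Rightarrow> 'a \<Rightarrow> 'a" B "scaleR :: real \<Rightarrow> 'a \<Rightarrow> 'a" B
    using fin B(2) sp by unfold_locales (auto simp: dependent_raw_def span_raw_def)
  \<comment> \<open>The coordinate vector of \<open>G a\<close>, placed in the same space so that \<open>T\<close> is an endomorphism.\<close>
  define T where "T a = (\<Sum>c\<in>B. G a c *\<^sub>R c)" for a
  have coeff: "\<forall>c\<in>B. u c = w c" if "(\<Sum>c\<in>B. u c *\<^sub>R c) = (\<Sum>c\<in>B. w c *\<^sub>R c)" for u w
  proof -
    have "(\<Sum>c\<in>B. (u c - w c) *\<^sub>R c) = 0" using that by (simp add: scaleR_diff_left sum_subtractf)
    then show ?thesis using independentD[OF B(2) fin order_refl] by fastforce
  qed
  have ext: "F = H" if "linear F" "linear H" "\<forall>c\<in>B. F c = H c" for F H :: "'a \<Rightarrow> real"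
    using linear_eq_on_span[OF that(1,2), of B] that(3) sp by auto
  have T: "linear T"
    unfolding T_def
    by (rule linearI) (simp_all add: linear_add[OF lin_left] linear_scale[OF lin_left]
      scaleR_add_left sum.distrib scaleR_sum_right)
  have "inj T"
  proof (subst linear_injective_0[OF T], safe)
    fix a assume "T a = 0"
    then have "\<forall>c\<in>B. G a c = 0" using coeff[of "G a" "\<lambda>_. 0"] by (simp add: T_def)
    then have "G a = (\<lambda>_. 0)" using ext[OF lin_right linear_zero] by blast
    then show "a = 0" using nondeg by metis
  qed
  then have "surj T" using V.linear_injective_imp_surjective[of T] T by (simp add: linear_def)
  then obtain a where "T a = (\<Sum>c\<in>B. L c *\<^sub>R c)" by (metis surjD)
  then have "\<forall>c\<in>B. G a c = L c" using coeff by (simp add: T_def)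
  then show ?thesis using ext[OF lin_right assms(5)] that by blast
qed


section \<open>Smooth functions on a manifold and bump functions\<close>

lemma chart_inv_into:
  assumes "smooth_atlas \<A>" "(U, \<phi>) \<in> \<A>" "q \<in> U"
  shows "inv_into U \<phi> (\<phi> q) = q"
  using assms unfolding smooth_atlas_def homeomorphism_def by blast

lemma chart_image_open:
  assumes "smooth_atlas \<A>" "(U, \<phi>) \<in> \<A>" "open W"
  shows "open (\<phi> ` (U \<inter> W))"
proof -
  have "continuous_on (\<phi> ` U) (inv_into U \<phi>)" "open (\<phi> ` U)"
    using assms(1,2) unfolding smooth_atlas_def homeomorphism_def by blast+
  then have "open (\<phi> ` U \<inter> inv_into U \<phi> -` W)"
    using assms(3) by (rule continuous_open_preimage)
  moreover have "\<phi> ` U \<inter> inv_into U \<phi> -` W = \<phi> ` (U \<inter> W)"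
    using chart_inv_into[OF assms(1,2)] by auto
  ultimately show ?thesis by simp
qed

lemma smooth_map_onI:
  assumes "\<And>U \<phi> k. (U, \<phi>) \<in> \<A> \<Longrightarrow> Ck_on k (\<lambda>x. h (inv_into U \<phi> x)) (\<phi> ` (U \<inter> W))"
  shows "smooth_map_on \<A> W h"
  using assms by (auto simp: smooth_map_on_def smooth_on_def o_def)

lemma smooth_map_onD:
  assumes "smooth_map_on \<A> W h" "(U, \<phi>) \<in> \<A>"
  shows "Ck_on k (\<lambda>x. h (inv_into U \<phi> x)) (\<phi> ` (U \<inter> W))"
  using assms by (auto simp: smooth_map_on_def smooth_on_def o_def)

lemma smooth_map_on_subset: "smooth_map_on \<A> W h \<Longrightarrow> V \<subseteq> W \<Longrightarrow> smooth_map_on \<A> V h"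
  by (rule smooth_map_onI, rule Ck_on_subset, rule smooth_map_onD) auto

lemma smooth_map_on_cong:
  assumes "smooth_atlas \<A>" "open W" "smooth_map_on \<A> W h" "\<And>q. q \<in> W \<Longrightarrow> h q = h' q"
  shows "smooth_map_on \<A> W h'"
proof (rule smooth_map_onI)
  fix U \<phi> k assume c: "(U, \<phi>) \<in> \<A>"
  show "Ck_on k (\<lambda>x. h' (inv_into U \<phi> x)) (\<phi> ` (U \<inter> W))"
    by (rule Ck_on_cong[OF chart_image_open[OF assms(1) c assms(2)] smooth_map_onD[OF assms(3) c]])
      (use chart_inv_into[OF assms(1) c] assms(4) in auto)
qed

lemma smooth_map_on_local:
  assumes "smooth_atlas \<A>"
    and loc: "\<And>p. p \<in> W \<Longrightarrow> \<exists>V. open V \<and> p \<in> V \<and> smooth_map_on \<A> V h"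
  shows "smooth_map_on \<A> W h"
proof (rule smooth_map_onI)
  fix U \<phi> k assume c: "(U, \<phi>) \<in> \<A>"
  let ?\<V> = "{V. open V \<and> smooth_map_on \<A> V h}"
  have "Ck_on k (\<lambda>x. h (inv_into U \<phi> x)) (\<Union>V\<in>?\<V>. \<phi> ` (U \<inter> V))"
    by (rule Ck_on_UN) (auto intro: chart_image_open[OF assms(1) c] smooth_map_onD[OF _ c])
  moreover have "\<phi> ` (U \<inter> W) \<subseteq> (\<Union>V\<in>?\<V>. \<phi> ` (U \<inter> V))" using loc by blast
  ultimately show "Ck_on k (\<lambda>x. h (inv_into U \<phi> x)) (\<phi> ` (U \<inter> W))" by (rule Ck_on_subset)
qed

lemma smooth_map_on_const: "smooth_atlas \<A> \<Longrightarrow> open W \<Longrightarrow> smooth_map_on \<A> W (\<lambda>q. c)"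
  by (intro smooth_map_onI Ck_on_const chart_image_open)

lemma smooth_map_on_add:
  assumes "smooth_atlas \<A>" "open W" "smooth_map_on \<A> W h" "smooth_map_on \<A> W h'"
  shows "smooth_map_on \<A> W (\<lambda>q. h q + h' q)"
  by (rule smooth_map_onI)
    (intro Ck_on_add chart_image_open[OF assms(1) _ assms(2)] smooth_map_onD[OF assms(3)]
      smooth_map_onD[OF assms(4)])

lemma smooth_map_on_bilinear:
  assumes "bounded_bilinear P" "smooth_atlas \<A>" "open W" "smooth_map_on \<A> W h" "smooth_map_on \<A> W h'"
  shows "smooth_map_on \<A> W (\<lambda>q. P (h q) (h' q))"
  by (rule smooth_map_onI)
    (intro Ck_on_bilinear[OF _ assms(1)] chart_image_open[OF assms(2) _ assms(3)]
      smooth_map_onD[OF assms(4)] smooth_map_onD[OF assms(5)])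

lemmas smooth_map_on_scaleR = smooth_map_on_bilinear[OF bounded_bilinear_scaleR]
  and smooth_map_on_mult = smooth_map_on_bilinear[OF bounded_bilinear_mult]
  and smooth_map_on_inner = smooth_map_on_bilinear[OF bounded_bilinear_inner]

lemma smooth_map_on_sum:
  assumes "smooth_atlas \<A>" "open W" "\<And>i. i \<in> I \<Longrightarrow> smooth_map_on \<A> W (h i)"
  shows "smooth_map_on \<A> W (\<lambda>q. \<Sum>i\<in>I. h i q)"
  using assms(3)
proof (induction I rule: infinite_finite_induct)
  case (insert i I)
  have "smooth_map_on \<A> W (\<lambda>q. h i q + (\<Sum>i\<in>I. h i q))"
    by (rule smooth_map_on_add[OF assms(1,2)]) (use insert in auto)
  then show ?case using insert.hyps by simp
qed (simp_all add: smooth_map_on_const[OF assms(1,2)])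

lemma smooth_map_on_flat_exp:
  assumes "smooth_atlas \<A>" "open W" "smooth_map_on \<A> W u"
  shows "smooth_map_on \<A> W (\<lambda>q. flat_exp 1 (u q))"
proof (rule smooth_map_onI)
  fix U \<phi> k assume c: "(U, \<phi>) \<in> \<A>"
  show "Ck_on k (\<lambda>x. flat_exp 1 (u (inv_into U \<phi> x))) (\<phi> ` (U \<inter> W))"
    using smooth_on_flat_exp_compose[OF chart_image_open[OF assms(1) c assms(2)]]
      smooth_map_onD[OF assms(3) c] unfolding smooth_on_def by blast
qed

text \<open>The way in which a locally defined object, cut off by a bump function supported in \<open>K\<close>, becomes a
  global one: \<open>V\<close> is covered by the open sets \<open>V \<inter> U\<close> and \<open>V - K\<close>.\<close>
lemma smooth_map_on_extend_zero:
  assumes "smooth_atlas \<A>" "open V" "open U" "closed K" "K \<subseteq> U"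
    and "smooth_map_on \<A> (V \<inter> U) h" "\<And>q. q \<in> V - K \<Longrightarrow> h q = 0"
  shows "smooth_map_on \<A> V h"
proof (rule smooth_map_on_local[OF assms(1)])
  have off: "smooth_map_on \<A> (V - K) h"
    by (rule smooth_map_on_cong[OF assms(1) _ smooth_map_on_const[OF assms(1)]])
      (use assms in auto)
  fix p assume "p \<in> V"
  show "\<exists>V'. open V' \<and> p \<in> V' \<and> smooth_map_on \<A> V' h"
  proof (cases "p \<in> K")
    case True
    then show ?thesis using assms \<open>p \<in> V\<close> by (intro exI[of _ "V \<inter> U"]) auto
  next
    case False
    then show ?thesis using assms off \<open>p \<in> V\<close> by (intro exI[of _ "V - K"]) auto
  qed
qed

lemma smooth_funs_const: "smooth_atlas \<A> \<Longrightarrow> (\<lambda>q. c) \<in> smooth_funs \<A>"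
  by (simp add: smooth_funs_def smooth_map_on_const)

lemma smooth_funs_add:
  "smooth_atlas \<A> \<Longrightarrow> f \<in> smooth_funs \<A> \<Longrightarrow> h \<in> smooth_funs \<A> \<Longrightarrow> (\<lambda>q. f q + h q) \<in> smooth_funs \<A>"
  by (simp add: smooth_funs_def smooth_map_on_add)

lemma smooth_funs_mult:
  "smooth_atlas \<A> \<Longrightarrow> f \<in> smooth_funs \<A> \<Longrightarrow> h \<in> smooth_funs \<A> \<Longrightarrow> (\<lambda>q. f q * h q) \<in> smooth_funs \<A>"
  by (simp add: smooth_funs_def smooth_map_on_mult)

lemma smooth_funs_diff:
  assumes "smooth_atlas \<A>" "f \<in> smooth_funs \<A>" "h \<in> smooth_funs \<A>"
  shows "(\<lambda>q. f q - h q) \<in> smooth_funs \<A>"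
  using smooth_funs_add[OF assms(1,2) smooth_funs_mult[OF assms(1) smooth_funs_const[OF assms(1), of "-1"] assms(3)]]
  by simp

lemma chart_smooth:
  assumes "smooth_atlas \<A>" "(U, \<phi>) \<in> \<A>"
  shows "smooth_map_on \<A> U \<phi>"
proof (rule smooth_map_onI)
  fix V \<psi> k assume "(V, \<psi>) \<in> \<A>"
  then have "smooth_on (\<phi> \<circ> inv_into V \<psi>) (\<psi> ` (V \<inter> U))"
    using assms unfolding smooth_atlas_def by blast
  then show "Ck_on k (\<lambda>x. \<phi> (inv_into V \<psi> x)) (\<psi> ` (V \<inter> U))"
    by (simp add: smooth_on_def o_def)
qed

text \<open>The function \<open>exp (- 1 / (r\<^sup>2 - |x|\<^sup>2))\<close> on a small closed ball in a chart. Its support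
  in the manifold is compact, hence closed as the manifold is Hausdorff; this is what makes the
  extension by zero smooth. Where a value 1 at \<open>p\<close> would be natural, one divides by \<open>b p\<close>.\<close>
lemma bump_function:
  fixes \<A> :: "('m::{t2_space,second_countable_topology}, 'e::real_inner) charts"
  assumes "smooth_atlas \<A>" "open W" "p \<in> W"
  obtains b K where "b \<in> smooth_funs \<A>" "closed K" "K \<subseteq> W" "b p \<noteq> 0" "\<And>q. q \<notin> K \<Longrightarrow> b q = 0"
proof -
  have "p \<in> (\<Union>(U, \<phi>)\<in>\<A>. U)" using assms(1) by (simp add: smooth_atlas_def)
  then obtain U \<phi> where c: "(U, \<phi>) \<in> \<A>" "p \<in> U" by auto
  have fin: "finite_dim (UNIV :: 'e set)" using assms(1) by (simp add: smooth_atlas_def)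
  have U: "open U" and cont: "continuous_on (\<phi> ` U) (inv_into U \<phi>)"
    using assms(1) c unfolding smooth_atlas_def homeomorphism_def by blast+
  obtain r where r: "r > 0" "cball (\<phi> p) r \<subseteq> \<phi> ` (U \<inter> W)"
    using open_contains_cball_eq[OF chart_image_open[OF assms(1) c(1) assms(2)]] c(2) assms(3) by blast
  define K where "K = inv_into U \<phi> ` cball (\<phi> p) r"
  have "compact K"
    unfolding K_def
    using r(2) by (intro compact_continuous_image compact_cball_finite_dim[OF fin]
        continuous_on_subset[OF cont]) auto
  then have K: "closed K" by (rule compact_imp_closed)
  have KW: "K \<subseteq> U \<inter> W" using r(2) chart_inv_into[OF assms(1) c(1)] unfolding K_def by fastforce
  define u where "u q = r\<^sup>2 + (-1) * ((\<phi> q - \<phi> p) \<bullet> (\<phi> q - \<phi> p))" for q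
  define b where "b q = (if q \<in> U then flat_exp 1 (u q) else 0)" for q
  have off: "b q = 0" if "q \<notin> K" for q
  proof (cases "q \<in> U")
    case True
    then have "\<phi> q \<notin> cball (\<phi> p) r"
      using that chart_inv_into[OF assms(1) c(1)] unfolding K_def by (metis imageI)
    then have "norm (\<phi> q - \<phi> p) > r" by (simp add: dist_norm norm_minus_commute)
    then have "u q \<le> 0"
      using r(1) power_mono[of r "norm (\<phi> q - \<phi> p)" 2]
      by (simp add: u_def dot_square_norm)
    then show ?thesis by (simp add: b_def flat_exp_def)
  qed (simp add: b_def)
  note S = assms(1) U
  have "smooth_map_on \<A> U (\<lambda>q. \<phi> q + (- \<phi> p))"
    by (rule smooth_map_on_add[OF S chart_smooth[OF assms(1) c(1)] smooth_map_on_const[OF S]])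
  then have d: "smooth_map_on \<A> U (\<lambda>q. \<phi> q - \<phi> p)" by simp
  have "smooth_map_on \<A> U u"
    unfolding u_def
    by (rule smooth_map_on_add[OF S smooth_map_on_const[OF S]
          smooth_map_on_mult[OF S smooth_map_on_const[OF S] smooth_map_on_inner[OF S d d]]])
  then have "smooth_map_on \<A> U (\<lambda>q. flat_exp 1 (u q))" by (rule smooth_map_on_flat_exp[OF S])
  then have "smooth_map_on \<A> U b"
    by (rule smooth_map_on_cong[OF assms(1) U]) (simp add: b_def)
  then have "smooth_map_on \<A> UNIV b"
    using KW by (intro smooth_map_on_extend_zero[OF assms(1) open_UNIV U K _ _ off]) simp_all
  then have "b \<in> smooth_funs \<A>" by (simp add: smooth_funs_def)
  moreover have "b p \<noteq> 0" using r(1) c(2) by (simp add: b_def u_def flat_exp_def)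
  ultimately show ?thesis using that K KW off by blast
qed


section \<open>Vector bundles and their sections\<close>

lemma lin_on_add: "lin_on V h \<Longrightarrow> u \<in> V \<Longrightarrow> w \<in> V \<Longrightarrow> h (u + w) = h u + h w"
  and lin_on_scaleR: "lin_on V h \<Longrightarrow> u \<in> V \<Longrightarrow> h (c *\<^sub>R u) = c *\<^sub>R h u"
  by (simp_all add: lin_on_def)

lemma lin_on_zero: "lin_on V h \<Longrightarrow> subspace V \<Longrightarrow> h 0 = 0"
  using lin_on_scaleR[of V h 0 0] by (simp add: subspace_0)

lemma lin_on_diff:
  assumes "lin_on V h" "subspace V" "u \<in> V" "w \<in> V"
  shows "h (u - w) = h u - h w"
proof -
  have "h (u + (- 1) *\<^sub>R w) = h u + (- 1) *\<^sub>R h w"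
    using assms by (simp only: lin_on_add lin_on_scaleR subspace_scale)
  then show ?thesis by simp
qed

lemma bundle_atlas: "vector_bundle A \<Longrightarrow> smooth_atlas (atlas A)"
  and bundle_fibre: "vector_bundle A \<Longrightarrow> subspace (fibre A p)"
  by (simp_all add: vector_bundle_def)

lemma bundle_triv:
  assumes "vector_bundle A" "(U, \<tau>) \<in> trivs A"
  shows "open U" "q \<in> U \<Longrightarrow> lin_on (fibre A q) (\<tau> q)" "q \<in> U \<Longrightarrow> bij_betw (\<tau> q) (fibre A q) UNIV"
  using assms unfolding vector_bundle_def by blast+

lemma bundle_triv_at:
  assumes "vector_bundle A"
  obtains U \<tau> where "(U, \<tau>) \<in> trivs A" "p \<in> U"
proof -
  have "p \<in> (\<Union>(U, \<tau>)\<in>trivs A. U)" using assms by (simp add: vector_bundle_def)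
  then show ?thesis using that by auto
qed

lemma triv_inv_props:
  assumes "vector_bundle A" "(U, \<tau>) \<in> trivs A" "q \<in> U"
  shows "triv_inv A \<tau> q a \<in> fibre A q"
    and "\<tau> q (triv_inv A \<tau> q a) = a"
    and "v \<in> fibre A q \<Longrightarrow> triv_inv A \<tau> q (\<tau> q v) = v"
  using bundle_triv(3)[OF assms]
  by (auto simp: bij_betw_def inv_into_into f_inv_into_f)

lemma linear_triv_inv:
  assumes "vector_bundle A" "(U, \<tau>) \<in> trivs A" "q \<in> U"
  shows "linear (triv_inv A \<tau> q)"
proof (rule linearI)
  note P = triv_inv_props[OF assms] and L = bundle_triv(2)[OF assms] and F = bundle_fibre[OF assms(1), of q]
  fix a b and c :: real
  have "\<tau> q (triv_inv A \<tau> q a + triv_inv A \<tau> q b) = a + b"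
    using P by (simp add: lin_on_add[OF L])
  then show "triv_inv A \<tau> q (a + b) = triv_inv A \<tau> q a + triv_inv A \<tau> q b"
    using P(3)[OF subspace_add[OF F P(1)[of a] P(1)[of b]]] by simp
  have "\<tau> q (c *\<^sub>R triv_inv A \<tau> q a) = c *\<^sub>R a"
    using P by (simp add: lin_on_scaleR[OF L])
  then show "triv_inv A \<tau> q (c *\<^sub>R a) = c *\<^sub>R triv_inv A \<tau> q a"
    using P(3)[OF subspace_scale[OF F P(1)[of a]]] by metis
qed

lemma sections_fibre: "X \<in> sections A \<Longrightarrow> X p \<in> fibre A p"
  by (simp add: sections_def)

lemma sections_smooth: "X \<in> sections A \<Longrightarrow> (U, \<tau>) \<in> trivs A \<Longrightarrow> smooth_map_on (atlas A) U (\<lambda>p. \<tau> p (X p))"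
  by (auto simp: sections_def)

lemma sectionsI:
  assumes "\<And>p. X p \<in> fibre A p"
    and "\<And>U \<tau>. (U, \<tau>) \<in> trivs A \<Longrightarrow> smooth_map_on (atlas A) U (\<lambda>p. \<tau> p (X p))"
  shows "X \<in> sections A"
  using assms by (auto simp: sections_def)

lemma sections_add:
  assumes "vector_bundle A" "X \<in> sections A" "Y \<in> sections A"
  shows "(\<lambda>p. X p + Y p) \<in> sections A"
proof (rule sectionsI)
  fix U \<tau> assume t: "(U, \<tau>) \<in> trivs A"
  note S = bundle_atlas[OF assms(1)] bundle_triv(1)[OF assms(1) t]
  show "smooth_map_on (atlas A) U (\<lambda>p. \<tau> p (X p + Y p))"
    by (rule smooth_map_on_cong[OF S smooth_map_on_add[OF S sections_smooth[OF assms(2) t]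
            sections_smooth[OF assms(3) t]]])
      (simp add: lin_on_add[OF bundle_triv(2)[OF assms(1) t]] sections_fibre assms)
qed (simp add: subspace_add bundle_fibre sections_fibre assms)

lemma sections_scaleR:
  assumes "vector_bundle A" "f \<in> smooth_funs (atlas A)" "X \<in> sections A"
  shows "(\<lambda>p. f p *\<^sub>R X p) \<in> sections A"
proof (rule sectionsI)
  fix U \<tau> assume t: "(U, \<tau>) \<in> trivs A"
  note S = bundle_atlas[OF assms(1)] bundle_triv(1)[OF assms(1) t]
  have f: "smooth_map_on (atlas A) U f"
    using assms(2) by (auto simp: smooth_funs_def intro: smooth_map_on_subset)
  show "smooth_map_on (atlas A) U (\<lambda>p. \<tau> p (f p *\<^sub>R X p))"
    by (rule smooth_map_on_cong[OF S smooth_map_on_scaleR[OF S f sections_smooth[OF assms(3) t]]])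
      (simp add: lin_on_scaleR[OF bundle_triv(2)[OF assms(1) t]] sections_fibre assms)
qed (simp add: subspace_scale bundle_fibre sections_fibre assms)

lemma sections_zero:
  assumes "vector_bundle A"
  shows "(\<lambda>p. 0) \<in> sections A"
proof (rule sectionsI)
  fix U \<tau> assume t: "(U, \<tau>) \<in> trivs A"
  note S = bundle_atlas[OF assms(1)] bundle_triv(1)[OF assms(1) t]
  show "smooth_map_on (atlas A) U (\<lambda>p. \<tau> p 0)"
    by (rule smooth_map_on_cong[OF S smooth_map_on_const[OF S, of 0]])
      (simp add: lin_on_zero[OF bundle_triv(2)[OF assms t] bundle_fibre[OF assms]])
qed (simp add: subspace_0 bundle_fibre assms)

lemma sections_sum:
  assumes "vector_bundle A" "finite I" "\<And>i. i \<in> I \<Longrightarrow> X i \<in> sections A"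
  shows "(\<lambda>p. \<Sum>i\<in>I. X i p) \<in> sections A"
  using assms(2,3) by (induction I) (simp_all add: sections_zero sections_add assms(1))

text \<open>A constant vector \<open>w\<close> of the model fibre, transported by the trivialization and multiplied by the cut-off
  function \<open>b\<close>. Letting \<open>w\<close> run through a basis gives a local frame made of global sections.\<close>
definition cut_off_frame ::
    "('m, 'e, 'v, 'f, 'z) vbundle_scheme \<Rightarrow> 'm set \<Rightarrow> ('m \<Rightarrow> 'v \<Rightarrow> 'f) \<Rightarrow> ('m \<Rightarrow> real) \<Rightarrow> 'f \<Rightarrow> 'm \<Rightarrow> 'v::real_vector"
  where "cut_off_frame A U \<tau> b w = (\<lambda>q. if q \<in> U then b q *\<^sub>R triv_inv A \<tau> q w else 0)"

lemma cut_off_frame_section: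
  assumes "vector_bundle A" "(U, \<tau>) \<in> trivs A" "b \<in> smooth_funs (atlas A)"
    and "closed K" "K \<subseteq> U" "\<And>q. q \<notin> K \<Longrightarrow> b q = 0"
  shows "cut_off_frame A U \<tau> b w \<in> sections A"
proof (rule sectionsI)
  show "cut_off_frame A U \<tau> b w q \<in> fibre A q" for q
    using triv_inv_props(1)[OF assms(1,2)]
    by (simp add: cut_off_frame_def subspace_scale subspace_0 bundle_fibre assms(1))
next
  fix V \<sigma> assume s: "(V, \<sigma>) \<in> trivs A"
  note at = bundle_atlas[OF assms(1)]
  note U = bundle_triv(1)[OF assms(1,2)] and V = bundle_triv(1)[OF assms(1) s]
  note L = bundle_triv(2)[OF assms(1) s]
  have o: "open (V \<inter> U)" using U V by auto
  have "smooth_map_on (atlas A) (U \<inter> V) (\<lambda>q. \<sigma> q (triv_inv A \<tau> q w))"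
    using assms(1,2) s unfolding vector_bundle_def by blast
  then have e: "smooth_map_on (atlas A) (V \<inter> U) (\<lambda>q. \<sigma> q (triv_inv A \<tau> q w))"
    by (simp add: Int_commute)
  have b: "smooth_map_on (atlas A) (V \<inter> U) b"
    using assms(3) by (auto simp: smooth_funs_def intro: smooth_map_on_subset)
  show "smooth_map_on (atlas A) V (\<lambda>q. \<sigma> q (cut_off_frame A U \<tau> b w q))"
  proof (rule smooth_map_on_extend_zero[OF at V U assms(4,5)])
    show "smooth_map_on (atlas A) (V \<inter> U) (\<lambda>q. \<sigma> q (cut_off_frame A U \<tau> b w q))"
      by (rule smooth_map_on_cong[OF at o smooth_map_on_scaleR[OF at o b e]])
        (simp add: cut_off_frame_def lin_on_scaleR[OF L] triv_inv_props(1)[OF assms(1,2)])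
    show "\<sigma> q (cut_off_frame A U \<tau> b w q) = 0" if "q \<in> V - K" for q
      using that assms(6) lin_on_zero[OF L bundle_fibre[OF assms(1)]]
      by (simp add: cut_off_frame_def)
  qed
qed

text \<open>Nondegeneracy of a metric is a condition on the vectors of a fibre, whereas \<open>sharp\<close> tests against
  sections; this lemma connects the two.\<close>
lemma section_through:
  assumes "vector_bundle A" "v \<in> fibre A p"
  obtains X where "X \<in> sections A" "X p = v"
proof -
  obtain U \<tau> where t: "(U, \<tau>) \<in> trivs A" "p \<in> U" by (rule bundle_triv_at[OF assms(1)])
  obtain b K where b: "b \<in> smooth_funs (atlas A)" "closed K" "K \<subseteq> U" "b p \<noteq> 0"
      "\<And>q. q \<notin> K \<Longrightarrow> b q = 0"
    using bump_function[OF bundle_atlas[OF assms(1)] bundle_triv(1)[OF assms(1) t(1)] t(2)] by metis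
  \<comment> \<open>The factor \<open>1 / b p\<close> compensates for the value of the bump function at \<open>p\<close>.\<close>
  let ?X = "cut_off_frame A U \<tau> b ((1 / b p) *\<^sub>R \<tau> p v)"
  have "?X p = v"
    using b(4) t(2) triv_inv_props(3)[OF assms(1) t assms(2)]
    by (simp add: cut_off_frame_def linear_scale[OF linear_triv_inv[OF assms(1) t]])
  with cut_off_frame_section[OF assms(1) t(1) b(1,2,3,5)] show ?thesis using that by blast
qed


section \<open>Pseudo-Riemannian metrics\<close>

lemma metric_sym:
  "pseudo_riemannian_metric A g \<Longrightarrow> v \<in> fibre A p \<Longrightarrow> w \<in> fibre A p \<Longrightarrow> g p v w = g p w v"
  by (simp add: pseudo_riemannian_metric_def)

lemma metric_right: "pseudo_riemannian_metric A g \<Longrightarrow> v \<in> fibre A p \<Longrightarrow> lin_on (fibre A p) (g p v)"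
  by (simp add: pseudo_riemannian_metric_def)

lemma metric_left:
  assumes "vector_bundle A" "pseudo_riemannian_metric A g" "v \<in> fibre A p"
  shows "lin_on (fibre A p) (\<lambda>w. g p w v)"
  unfolding lin_on_def
proof (intro conjI ballI allI)
  note R = metric_right[OF assms(2,3)] and F = bundle_fibre[OF assms(1), of p]
  fix u w and c :: real assume u: "u \<in> fibre A p"
  show "g p (c *\<^sub>R u) v = c *\<^sub>R g p u v"
    using lin_on_scaleR[OF R u] metric_sym[OF assms(2) u assms(3)]
      metric_sym[OF assms(2) subspace_scale[OF F u] assms(3)] by simp
  assume w: "w \<in> fibre A p"
  show "g p (u + w) v = g p u v + g p w v"
    using lin_on_add[OF R u w] metric_sym[OF assms(2) u assms(3)] metric_sym[OF assms(2) w assms(3)]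
      metric_sym[OF assms(2) subspace_add[OF F u w] assms(3)] by simp
qed

lemma linear_metric_triv:
  assumes "vector_bundle A" "pseudo_riemannian_metric A g" "(U, \<tau>) \<in> trivs A" "q \<in> U"
  shows "linear (\<lambda>b. g q (triv_inv A \<tau> q a) (triv_inv A \<tau> q b))"
    and "linear (\<lambda>a. g q (triv_inv A \<tau> q a) (triv_inv A \<tau> q b))"
proof -
  note P = triv_inv_props(1)[OF assms(1,3,4)] and T = linear_triv_inv[OF assms(1,3,4)]
  show "linear (\<lambda>b. g q (triv_inv A \<tau> q a) (triv_inv A \<tau> q b))"
    by (rule linearI) (simp_all add: linear_add[OF T] linear_scale[OF T] P
      lin_on_add[OF metric_right[OF assms(2)]] lin_on_scaleR[OF metric_right[OF assms(2)], simplified])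
  show "linear (\<lambda>a. g q (triv_inv A \<tau> q a) (triv_inv A \<tau> q b))"
    by (rule linearI) (simp_all add: linear_add[OF T] linear_scale[OF T] P
      lin_on_add[OF metric_left[OF assms(1,2)]] lin_on_scaleR[OF metric_left[OF assms(1,2)], simplified])
qed

text \<open>In a trivialization \<open>g(X,Y)\<close> is a finite sum of products of the coordinates of \<open>X\<close> and \<open>Y\<close> and of the
  coefficients of \<open>g\<close>. Smoothness matters because the anchor acts as a derivation
  only on smooth functions.\<close>
lemma metric_smooth:
  fixes A :: "('m::{t2_space,second_countable_topology}, 'e::real_inner, 'v::real_vector, 'f::real_inner, 'z)
       vbundle_scheme"
  assumes "vector_bundle A" "pseudo_riemannian_metric A g" "X \<in> sections A" "Y \<in> sections A"
  shows "(\<lambda>p. g p (X p) (Y p)) \<in> smooth_funs (atlas A)"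
proof -
  note at = bundle_atlas[OF assms(1)]
  have "finite_dim (UNIV :: 'f set)" using assms(1) by (simp add: vector_bundle_def)
  then obtain C :: "'f set" and d :: "'f \<Rightarrow> 'f"
    where C: "finite C" "\<And>x. x = (\<Sum>c\<in>C. (x \<bullet> c) *\<^sub>R d c)"
    by (rule finite_dim_expansion) (rule that)
  have "smooth_map_on (atlas A) U (\<lambda>p. g p (X p) (Y p))" if t: "(U, \<tau>) \<in> trivs A" for U \<tau>
  proof -
    note S = at bundle_triv(1)[OF assms(1) t]
    let ?e = "\<lambda>q c. triv_inv A \<tau> q (d c)"
    have coord: "smooth_map_on (atlas A) U (\<lambda>q. \<tau> q (Z q) \<bullet> c)" if "Z \<in> sections A" for Z and c :: 'f
      by (rule smooth_map_on_inner[OF S sections_smooth[OF that t] smooth_map_on_const[OF S]])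
    have G: "smooth_map_on (atlas A) U (\<lambda>q. g q (?e q c) (?e q c'))" for c c'
      using assms(2) t unfolding pseudo_riemannian_metric_def by blast
    have "smooth_map_on (atlas A) U (\<lambda>q. \<Sum>c\<in>C. \<Sum>c'\<in>C.
        (\<tau> q (X q) \<bullet> c) * ((\<tau> q (Y q) \<bullet> c') * g q (?e q c) (?e q c')))"
      by (rule smooth_map_on_sum[OF S], rule smooth_map_on_sum[OF S],
          rule smooth_map_on_mult[OF S coord[OF assms(3)]],
          rule smooth_map_on_mult[OF S coord[OF assms(4)] G])
    then show ?thesis
    proof (rule smooth_map_on_cong[OF S])
      fix q assume q: "q \<in> U"
      note P = triv_inv_props(3)[OF assms(1) t q]
      note lin = linear_metric_triv[OF assms(1,2) t q]
      let ?G = "\<lambda>a b. g q (triv_inv A \<tau> q a) (triv_inv A \<tau> q b)"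
      have "g q (X q) (Y q) = ?G (\<tau> q (X q)) (\<tau> q (Y q))"
        using P[OF sections_fibre[OF assms(3)]] P[OF sections_fibre[OF assms(4)]] by simp
      also have "\<dots> = ?G (\<Sum>c\<in>C. (\<tau> q (X q) \<bullet> c) *\<^sub>R d c) (\<Sum>c\<in>C. (\<tau> q (Y q) \<bullet> c) *\<^sub>R d c)"
        using C(2)[of "\<tau> q (X q)"] C(2)[of "\<tau> q (Y q)"] by (rule arg_cong2)
      also have "\<dots> = (\<Sum>c\<in>C. (\<tau> q (X q) \<bullet> c) * ?G (d c) (\<Sum>c\<in>C. (\<tau> q (Y q) \<bullet> c) *\<^sub>R d c))"
        by (simp add: linear_sum[OF lin(2)] linear_scale[OF lin(2)])
      also have "\<dots> = (\<Sum>c\<in>C. \<Sum>c'\<in>C. (\<tau> q (X q) \<bullet> c) * ((\<tau> q (Y q) \<bullet> c') * ?G (d c) (d c')))"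
        by (simp add: linear_sum[OF lin(1)] linear_scale[OF lin(1)] sum_distrib_left)
      finally show "(\<Sum>c\<in>C. \<Sum>c'\<in>C. (\<tau> q (X q) \<bullet> c) * ((\<tau> q (Y q) \<bullet> c') * ?G (d c) (d c')))
          = g q (X q) (Y q)" by (rule sym)
    qed
  qed
  then show ?thesis
    unfolding smooth_funs_def mem_Collect_eq
    by (intro smooth_map_on_local[OF at]) (metis bundle_triv_at bundle_triv(1) assms(1))
qed


section \<open>One-forms and the sharp operator\<close>

text \<open>Sections of the dual bundle, described as the \<open>C\<^sup>\<infinity>(M)\<close>-linear maps from sections to smooth functions.\<close>
definition smooth_one_form ::
    "('m, 'e::real_normed_vector, 'v::real_vector, 'f::real_normed_vector, 'z) vbundle_scheme \<Rightarrow>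
     ('m, 'v) one_form \<Rightarrow> bool" where
  "smooth_one_form A \<omega> \<longleftrightarrow>
     (\<forall>X\<in>sections A. \<omega> X \<in> smooth_funs (atlas A)) \<and>
     (\<forall>X\<in>sections A. \<forall>Y\<in>sections A. \<omega> (\<lambda>p. X p + Y p) = (\<lambda>p. \<omega> X p + \<omega> Y p)) \<and>
     (\<forall>f\<in>smooth_funs (atlas A). \<forall>X\<in>sections A. \<omega> (\<lambda>p. f p *\<^sub>R X p) = (\<lambda>p. f p * \<omega> X p))"

lemma smooth_one_formD:
  assumes "smooth_one_form A \<omega>" "X \<in> sections A"
  shows "\<omega> X \<in> smooth_funs (atlas A)"
    and "Y \<in> sections A \<Longrightarrow> \<omega> (\<lambda>p. X p + Y p) = (\<lambda>p. \<omega> X p + \<omega> Y p)"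
    and "f \<in> smooth_funs (atlas A) \<Longrightarrow> \<omega> (\<lambda>p. f p *\<^sub>R X p) = (\<lambda>p. f p * \<omega> X p)"
  using assms by (auto simp: smooth_one_form_def)

lemma smooth_one_form_zero:
  assumes "vector_bundle A" "smooth_one_form A \<omega>"
  shows "\<omega> (\<lambda>p. 0) p = 0"
  using smooth_one_formD(3)[OF assms(2) sections_zero[OF assms(1)]
      smooth_funs_const[OF bundle_atlas[OF assms(1)], of 0]]
  by (simp add: fun_eq_iff)

lemma smooth_one_form_sum:
  assumes "vector_bundle A" "smooth_one_form A \<omega>" "finite I" "\<And>i. i \<in> I \<Longrightarrow> X i \<in> sections A"
  shows "\<omega> (\<lambda>p. \<Sum>i\<in>I. X i p) q = (\<Sum>i\<in>I. \<omega> (X i) q)"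
  using assms(3,4)
proof (induction I)
  case empty
  then show ?case by (simp add: smooth_one_form_zero[OF assms(1,2)])
next
  case (insert i I)
  have "(\<lambda>p. \<Sum>i\<in>I. X i p) \<in> sections A"
    by (rule sections_sum[OF assms(1)]) (use insert in auto)
  then have "\<omega> (\<lambda>p. X i p + (\<Sum>i\<in>I. X i p)) q = \<omega> (X i) q + \<omega> (\<lambda>p. \<Sum>i\<in>I. X i p) q"
    using smooth_one_formD(2)[OF assms(2)] insert.prems by (simp add: fun_eq_iff)
  then show ?case using insert by simp
qed

text \<open>The tensor property. With a bump function \<open>b\<close> at \<open>p\<close> supported in a trivialization, the section
  \<open>b\<^sup>2 X\<close> is globally the combination \<open>\<Sum> (b x\<^sub>c) (b e\<^sub>c)\<close> of global sections with smooth coefficients,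
  one factor \<open>b\<close> extending the coordinate \<open>x\<^sub>c\<close> and the other one the frame \<open>e\<^sub>c\<close>. Applying \<open>\<omega>\<close>
  gives \<open>b(p)\<^sup>2 \<omega>(X)(p)\<close> as a sum of terms with the factors \<open>x\<^sub>c(p) = 0\<close>.\<close>
lemma smooth_one_form_vanish:
  fixes A :: "('m::{t2_space,second_countable_topology}, 'e::real_inner, 'v::real_vector, 'f::real_inner, 'z)
       vbundle_scheme"
  assumes "vector_bundle A" "smooth_one_form A \<omega>" "X \<in> sections A" "X p = 0"
  shows "\<omega> X p = 0"
proof -
  note at = bundle_atlas[OF assms(1)]
  obtain U \<tau> where t: "(U, \<tau>) \<in> trivs A" "p \<in> U" by (rule bundle_triv_at[OF assms(1)])
  note U = bundle_triv(1)[OF assms(1) t(1)]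
  obtain b K where b: "b \<in> smooth_funs (atlas A)" "closed K" "K \<subseteq> U" "b p \<noteq> 0"
      "\<And>q. q \<notin> K \<Longrightarrow> b q = 0"
    using bump_function[OF at U t(2)] by metis
  have "finite_dim (UNIV :: 'f set)" using assms(1) by (simp add: vector_bundle_def)
  then obtain C :: "'f set" and d :: "'f \<Rightarrow> 'f"
    where C: "finite C" "\<And>x. x = (\<Sum>c\<in>C. (x \<bullet> c) *\<^sub>R d c)"
    by (rule finite_dim_expansion) (rule that)
  define x where "x c q = b q * (\<tau> q (X q) \<bullet> c)" for c q
  define e where "e c = cut_off_frame A U \<tau> b (d c)" for c
  have e: "e c \<in> sections A" for c
    unfolding e_def by (rule cut_off_frame_section[OF assms(1) t(1) b(1,2,3,5)])
  have x: "x c \<in> smooth_funs (atlas A)" for c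
  proof -
    have "smooth_map_on (atlas A) U b"
      using b(1) by (auto simp: smooth_funs_def intro: smooth_map_on_subset)
    then have "smooth_map_on (atlas A) U (x c)"
      unfolding x_def
      by (rule smooth_map_on_mult[OF at U _
            smooth_map_on_inner[OF at U sections_smooth[OF assms(3) t(1)] smooth_map_on_const[OF at U]]])
    then have "smooth_map_on (atlas A) UNIV (x c)"
      using b(5) by (intro smooth_map_on_extend_zero[OF at open_UNIV U b(2,3)]) (simp_all add: x_def)
    then show ?thesis by (simp add: smooth_funs_def)
  qed
  have expand: "(b q * b q) *\<^sub>R X q = (\<Sum>c\<in>C. x c q *\<^sub>R e c q)" for q
  proof (cases "q \<in> U")
    case True
    note T = linear_triv_inv[OF assms(1) t(1) True]
    have "X q = triv_inv A \<tau> q (\<tau> q (X q))"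
      using triv_inv_props(3)[OF assms(1) t(1) True sections_fibre[OF assms(3)]] by simp
    also have "\<dots> = triv_inv A \<tau> q (\<Sum>c\<in>C. (\<tau> q (X q) \<bullet> c) *\<^sub>R d c)"
      using C(2)[of "\<tau> q (X q)"] by (rule arg_cong)
    also have "\<dots> = (\<Sum>c\<in>C. (\<tau> q (X q) \<bullet> c) *\<^sub>R triv_inv A \<tau> q (d c))"
      by (simp add: linear_sum[OF T] linear_scale[OF T])
    finally have "(b q * b q) *\<^sub>R X q = (b q * b q) *\<^sub>R (\<Sum>c\<in>C. (\<tau> q (X q) \<bullet> c) *\<^sub>R triv_inv A \<tau> q (d c))"
      by (rule arg_cong)
    also have "\<dots> = (\<Sum>c\<in>C. x c q *\<^sub>R e c q)"
      using True by (simp add: scaleR_sum_right x_def e_def cut_off_frame_def mult_ac)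
    finally show ?thesis .
  next
    case False
    then have "b q = 0" using b(3,5) by blast
    then show ?thesis by (simp add: x_def)
  qed
  have "(b p * b p) * \<omega> X p = \<omega> (\<lambda>q. (b q * b q) *\<^sub>R X q) p"
    using smooth_one_formD(3)[OF assms(2,3) smooth_funs_mult[OF at b(1) b(1)]]
    by (simp add: fun_eq_iff)
  also have "\<dots> = (\<Sum>c\<in>C. \<omega> (\<lambda>q. x c q *\<^sub>R e c q) p)"
    unfolding expand
    by (rule smooth_one_form_sum[OF assms(1,2) C(1)]) (rule sections_scaleR[OF assms(1) x e])
  also have "\<dots> = (\<Sum>c\<in>C. x c p * \<omega> (e c) p)"
    using smooth_one_formD(3)[OF assms(2) e x] by (simp add: fun_eq_iff)
  also have "\<dots> = 0"
    using lin_on_zero[OF bundle_triv(2)[OF assms(1) t] bundle_fibre[OF assms(1)]] assms(4)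
    by (simp add: x_def)
  finally show ?thesis using b(4) by simp
qed

lemma smooth_one_form_pointwise:
  fixes A :: "('m::{t2_space,second_countable_topology}, 'e::real_inner, 'v::real_vector, 'f::real_inner, 'z)
       vbundle_scheme"
  assumes "vector_bundle A" "smooth_one_form A \<omega>" "X \<in> sections A" "Y \<in> sections A" "X p = Y p"
  shows "\<omega> X p = \<omega> Y p"
proof -
  have m: "(\<lambda>q. - 1) \<in> smooth_funs (atlas A)" by (rule smooth_funs_const[OF bundle_atlas[OF assms(1)]])
  have n: "(\<lambda>q. (- 1) *\<^sub>R Y q) \<in> sections A" by (rule sections_scaleR[OF assms(1) m assms(4)])
  have "\<omega> (\<lambda>q. X q + (- 1) *\<^sub>R Y q) p = 0"
    by (rule smooth_one_form_vanish[OF assms(1,2) sections_add[OF assms(1,3) n]]) (simp add: assms(5))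
  then show ?thesis
    using smooth_one_formD(2)[OF assms(2,3) n] smooth_one_formD(3)[OF assms(2,4) m]
    by (simp add: fun_eq_iff)
qed

text \<open>The defining property of \<open>sharp\<close>. By the tensor property \<open>\<omega>\<close> induces a linear functional on the fibre
  at \<open>p\<close>, which the nondegenerate metric represents by a vector of the fibre; this
  vector is unique because sections pass through every vector of the fibre.\<close>
lemma metric_sharp:
  fixes A :: "('m::{t2_space,second_countable_topology}, 'e::real_inner, 'v::real_vector, 'f::real_inner, 'z)
       vbundle_scheme"
  assumes "vector_bundle A" "pseudo_riemannian_metric A g" "smooth_one_form A \<omega>" "Z \<in> sections A"
  shows "g p (sharp A g \<omega> p) (Z p) = \<omega> Z p"
proof -
  obtain U \<tau> where t: "(U, \<tau>) \<in> trivs A" "p \<in> U" by (rule bundle_triv_at[OF assms(1)])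
  note P = triv_inv_props[OF assms(1) t] and T = linear_triv_inv[OF assms(1) t]
  note F = bundle_fibre[OF assms(1), of p]
  have fin: "finite_dim (UNIV :: 'f set)" using assms(1) by (simp add: vector_bundle_def)
  let ?G = "\<lambda>a b. g p (triv_inv A \<tau> p a) (triv_inv A \<tau> p b)"
  have nondeg_fibre: "v = 0" if "v \<in> fibre A p" "\<And>w. w \<in> fibre A p \<Longrightarrow> g p v w = 0" for v
    using assms(2) that unfolding pseudo_riemannian_metric_def by blast
  have nondeg: "a = 0" if G0: "\<forall>b. ?G a b = 0" for a
  proof -
    have "triv_inv A \<tau> p a = 0"
    proof (rule nondeg_fibre[OF P(1)])
      show "g p (triv_inv A \<tau> p a) w = 0" if "w \<in> fibre A p" for w
        using spec[OF G0, of "\<tau> p w"] P(3)[OF that] by simp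
    qed
    then show ?thesis using P(2)[of a] P(2)[of 0] linear_0[OF T] by simp
  qed
  have "\<forall>a. \<exists>X. X \<in> sections A \<and> X p = triv_inv A \<tau> p a"
    using section_through[OF assms(1) P(1)] by metis
  \<comment> \<open>\<open>S a\<close> is an arbitrary section through the vector with coordinates \<open>a\<close>; it need not be linear in \<open>a\<close>,
    but the value of \<open>\<omega> (S a)\<close> at \<open>p\<close> is.\<close>
  then obtain S where S: "\<And>a. S a \<in> sections A" "\<And>a. S a p = triv_inv A \<tau> p a" by metis
  have L: "linear (\<lambda>a. \<omega> (S a) p)"
  proof (rule linearI)
    fix a b and c :: real
    have "\<omega> (S (a + b)) p = \<omega> (\<lambda>q. S a q + S b q) p"
      by (rule smooth_one_form_pointwise[OF assms(1,3) S(1) sections_add[OF assms(1) S(1) S(1)]])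
        (simp add: S(2) linear_add[OF T])
    then show "\<omega> (S (a + b)) p = \<omega> (S a) p + \<omega> (S b) p"
      using smooth_one_formD(2)[OF assms(3) S(1) S(1)] by (simp add: fun_eq_iff)
    have c: "(\<lambda>q. c) \<in> smooth_funs (atlas A)" by (rule smooth_funs_const[OF bundle_atlas[OF assms(1)]])
    have "\<omega> (S (c *\<^sub>R a)) p = \<omega> (\<lambda>q. c *\<^sub>R S a q) p"
      by (rule smooth_one_form_pointwise[OF assms(1,3) S(1) sections_scaleR[OF assms(1) c S(1)]])
        (simp add: S(2) linear_scale[OF T])
    then show "\<omega> (S (c *\<^sub>R a)) p = c *\<^sub>R \<omega> (S a) p"
      using smooth_one_formD(3)[OF assms(3) S(1) c] by (simp add: fun_eq_iff)
  qed
  obtain a where a: "?G a = (\<lambda>b. \<omega> (S b) p)"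
    by (rule nondegenerate_form_represents[where G = ?G, OF fin linear_metric_triv(2)[OF assms(1,2) t]
          linear_metric_triv(1)[OF assms(1,2) t] _ L]) (rule nondeg, assumption, rule that)
  let ?v = "triv_inv A \<tau> p a"
  have rep: "g p ?v (X p) = \<omega> X p" if X: "X \<in> sections A" for X
  proof -
    note Xp = P(3)[OF sections_fibre[OF X]]
    have "g p ?v (X p) = \<omega> (S (\<tau> p (X p))) p" using fun_cong[OF a, of "\<tau> p (X p)"] Xp by simp
    also have "\<dots> = \<omega> X p"
      by (rule smooth_one_form_pointwise[OF assms(1,3) S(1) X]) (simp add: S(2) Xp)
    finally show ?thesis .
  qed
  have "sharp A g \<omega> p = ?v"
    unfolding sharp_def
  proof (rule the_equality)
    show "?v \<in> fibre A p \<and> (\<forall>X\<in>sections A. g p ?v (X p) = \<omega> X p)" using P(1) rep by blast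
    fix v assume v: "v \<in> fibre A p \<and> (\<forall>X\<in>sections A. g p v (X p) = \<omega> X p)"
    have "v - ?v = 0"
    proof (rule nondeg_fibre)
      show "v - ?v \<in> fibre A p" using v P(1) F by (simp add: subspace_diff)
      fix w assume w: "w \<in> fibre A p"
      obtain X where X: "X \<in> sections A" "X p = w" by (rule section_through[OF assms(1) w])
      have "g p v (X p) = \<omega> X p" using v X(1) by blast
      then show "g p (v - ?v) w = 0"
        using lin_on_diff[OF metric_left[OF assms(1,2) w] F conjunct1[OF v] P(1)[of a]] rep[OF X(1)]
        by (simp add: X(2))
    qed
    then show "v = ?v" by simp
  qed
  with rep[OF assms(4)] show ?thesis by simp
qed


section \<open>The one-forms of a skew-symmetric algebroid\<close>

lemma algebroid_bundle: "skew_symmetric_algebroid A \<Longrightarrow> vector_bundle A"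
  by (simp add: skew_symmetric_algebroid_def)

lemma anchor_act_smooth:
  "skew_symmetric_algebroid A \<Longrightarrow> X \<in> sections A \<Longrightarrow> f \<in> smooth_funs (atlas A) \<Longrightarrow>
   anchor_act A X f \<in> smooth_funs (atlas A)"
  by (simp add: skew_symmetric_algebroid_def anchor_hom_def)

lemma anchor_act_derivation:
  assumes "skew_symmetric_algebroid A" "X \<in> sections A"
    and "f \<in> smooth_funs (atlas A)" "h \<in> smooth_funs (atlas A)"
  shows "anchor_act A X (\<lambda>q. f q + h q) p = anchor_act A X f p + anchor_act A X h p"
    and "anchor_act A X (\<lambda>q. f q * h q) p = anchor_act A X f p * h p + f p * anchor_act A X h p"
proof -
  have "anchor A p (X p) \<in> tangent_space (atlas A) p"
    using assms(1) sections_fibre[OF assms(2)]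
    by (simp add: skew_symmetric_algebroid_def anchor_hom_def)
  then show "anchor_act A X (\<lambda>q. f q + h q) p = anchor_act A X f p + anchor_act A X h p"
    and "anchor_act A X (\<lambda>q. f q * h q) p = anchor_act A X f p * h p + f p * anchor_act A X h p"
    using assms(3,4) by (simp_all add: tangent_space_def anchor_act_def)
qed

lemma bracket_section:
  "skew_symmetric_algebroid A \<Longrightarrow> X \<in> sections A \<Longrightarrow> Y \<in> sections A \<Longrightarrow> bracket A X Y \<in> sections A"
  unfolding skew_symmetric_algebroid_def R_bilinear_on_sections_def by blast

lemma bracket_add_right:
  "skew_symmetric_algebroid A \<Longrightarrow> X \<in> sections A \<Longrightarrow> Y \<in> sections A \<Longrightarrow> Z \<in> sections A \<Longrightarrow>
   bracket A X (\<lambda>p. Y p + Z p) = (\<lambda>p. bracket A X Y p + bracket A X Z p)"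
  unfolding skew_symmetric_algebroid_def R_bilinear_on_sections_def by blast

lemma bracket_Leibniz:
  "skew_symmetric_algebroid A \<Longrightarrow> X \<in> sections A \<Longrightarrow> Y \<in> sections A \<Longrightarrow> f \<in> smooth_funs (atlas A) \<Longrightarrow>
   bracket A X (\<lambda>p. f p *\<^sub>R Y p) = (\<lambda>p. f p *\<^sub>R bracket A X Y p + anchor_act A X f p *\<^sub>R Y p)"
  unfolding skew_symmetric_algebroid_def by blast

lemma smooth_one_form_flat:
  fixes A :: "('m::{t2_space,second_countable_topology}, 'e::real_inner, 'v::real_vector, 'f::real_inner, 'z)
       vbundle_scheme"
  assumes "vector_bundle A" "pseudo_riemannian_metric A g" "X \<in> sections A"
  shows "smooth_one_form A (flat g X)"
  unfolding smooth_one_form_def flat_def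
proof (intro conjI ballI ext)
  note R = metric_right[OF assms(2) sections_fibre[OF assms(3)]]
  show "(\<lambda>p. g p (X p) (Y p)) \<in> smooth_funs (atlas A)" if "Y \<in> sections A" for Y
    by (rule metric_smooth[OF assms(1,2,3) that])
  show "g p (X p) (Y p + Z p) = g p (X p) (Y p) + g p (X p) (Z p)"
    if "Y \<in> sections A" "Z \<in> sections A" for Y Z p
    using lin_on_add[OF R] that by (simp add: sections_fibre)
  show "g p (X p) (f p *\<^sub>R Y p) = f p * g p (X p) (Y p)" if "Y \<in> sections A" for f Y p
    using lin_on_scaleR[OF R] that by (simp add: sections_fibre)
qed

lemma smooth_one_form_d_alt:
  assumes "skew_symmetric_algebroid A" "f \<in> smooth_funs (atlas A)"
  shows "smooth_one_form A (d_alt A f)"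
  unfolding smooth_one_form_def d_alt_def
proof (intro conjI ballI ext)
  have L: "lin_on (fibre A p) (\<lambda>v. anchor A p v f)" for p
    using assms(1) by (simp add: skew_symmetric_algebroid_def anchor_hom_def)
  show "anchor_act A X f \<in> smooth_funs (atlas A)" if "X \<in> sections A" for X
    by (rule anchor_act_smooth[OF assms(1) that assms(2)])
  show "anchor_act A (\<lambda>q. X q + Y q) f p = anchor_act A X f p + anchor_act A Y f p"
    if "X \<in> sections A" "Y \<in> sections A" for X Y p
    unfolding anchor_act_def using lin_on_add[OF L] that by (simp add: sections_fibre)
  show "anchor_act A (\<lambda>q. h q *\<^sub>R X q) f p = h p * anchor_act A X f p" if "X \<in> sections A" for h X p
    unfolding anchor_act_def using lin_on_scaleR[OF L] that by (simp add: sections_fibre)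
qed

text \<open>Function-linearity holds because the term \<open>X(f) \<omega>(Y)\<close> from the derivation rule of the anchor cancels
  the one from the Leibniz rule of the bracket.\<close>
lemma smooth_one_form_lie_alt:
  assumes "skew_symmetric_algebroid A" "X \<in> sections A" "smooth_one_form A \<omega>"
  shows "smooth_one_form A (lie_alt A X \<omega>)"
  unfolding smooth_one_form_def lie_alt_def
proof (intro conjI ballI ext)
  note vb = algebroid_bundle[OF assms(1)] and W = smooth_one_formD[OF assms(3)]
  note at = bundle_atlas[OF vb] and br = bracket_section[OF assms(1,2)]
  note act = anchor_act_smooth[OF assms(1,2)]
  show "(\<lambda>p. anchor_act A X (\<omega> Y) p - \<omega> (bracket A X Y) p) \<in> smooth_funs (atlas A)"
    if Y: "Y \<in> sections A" for Y
    by (rule smooth_funs_diff[OF at act[OF W(1)[OF Y]] W(1)[OF br[OF Y]]])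
  show "anchor_act A X (\<omega> (\<lambda>p. Y p + Z p)) p - \<omega> (bracket A X (\<lambda>p. Y p + Z p)) p =
      anchor_act A X (\<omega> Y) p - \<omega> (bracket A X Y) p + (anchor_act A X (\<omega> Z) p - \<omega> (bracket A X Z) p)"
    if Y: "Y \<in> sections A" and Z: "Z \<in> sections A" for Y Z p
    by (simp add: W(2)[OF Y Z] bracket_add_right[OF assms(1,2) Y Z] W(2)[OF br[OF Y] br[OF Z]]
        anchor_act_derivation(1)[OF assms(1,2) W(1)[OF Y] W(1)[OF Z]])
  show "anchor_act A X (\<omega> (\<lambda>p. f p *\<^sub>R Y p)) p - \<omega> (bracket A X (\<lambda>p. f p *\<^sub>R Y p)) p =
      f p * (anchor_act A X (\<omega> Y) p - \<omega> (bracket A X Y) p)"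
    if f: "f \<in> smooth_funs (atlas A)" and Y: "Y \<in> sections A" for f Y p
    by (simp add: W(3)[OF Y f] bracket_Leibniz[OF assms(1,2) Y f]
        W(2)[OF sections_scaleR[OF vb f br[OF Y]] sections_scaleR[OF vb act[OF f] Y]]
        W(3)[OF br[OF Y] f] W(3)[OF Y act[OF f]]
        anchor_act_derivation(2)[OF assms(1,2) f W(1)[OF Y]] algebra_simps)
qed

lemma smooth_one_form_add:
  assumes "vector_bundle A" "smooth_one_form A \<omega>" "smooth_one_form A \<eta>"
  shows "smooth_one_form A (\<lambda>X p. \<omega> X p + \<eta> X p)"
  using smooth_one_formD[OF assms(2)] smooth_one_formD[OF assms(3)]
  by (simp add: smooth_one_form_def smooth_funs_add bundle_atlas[OF assms(1)] algebra_simps)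

lemma smooth_one_form_diff:
  assumes "vector_bundle A" "smooth_one_form A \<omega>" "smooth_one_form A \<eta>"
  shows "smooth_one_form A (\<lambda>X p. \<omega> X p - \<eta> X p)"
  using smooth_one_formD[OF assms(2)] smooth_one_formD[OF assms(3)]
  by (simp add: smooth_one_form_def smooth_funs_diff bundle_atlas[OF assms(1)] algebra_simps)


section \<open>The symmetric bracket of a connection\<close>

lemma connection_section:
  "connection A nab \<Longrightarrow> X \<in> sections A \<Longrightarrow> Y \<in> sections A \<Longrightarrow> nab X Y \<in> sections A"
  by (simp add: connection_def R_bilinear_on_sections_def)

text \<open>The Leibniz formula \<open>(\<nabla>\<^sub>X g)(Y,Z) = X(g(Y,Z)) - g(\<nabla>\<^sub>X Y,Z) - g(Y,\<nabla>\<^sub>X Z)\<close>, with the sum over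
  argument positions written out.\<close>
lemma cov_deriv_metric:
  "cov_deriv A nab X (metric_tensor g) [Y, Z] p =
     anchor_act A X (\<lambda>q. g q (Y q) (Z q)) p - g p (nab X Y p) (Z p) - g p (Y p) (nab X Z p)"
  by (simp add: cov_deriv_def metric_tensor_def numeral_2_eq_2)

theorem theorem4p2:
  fixes A :: "('m::{t2_space,second_countable_topology}, 'e::real_inner, 'v::real_vector, 'f::real_inner)
                algebroid"
    and g :: "'m \<Rightarrow> 'v \<Rightarrow> 'v \<Rightarrow> real"
    and nab :: "('m \<Rightarrow> 'v) \<Rightarrow> ('m \<Rightarrow> 'v) \<Rightarrow> ('m \<Rightarrow> 'v)"
    and X Y Z :: "'m \<Rightarrow> 'v"
    and p :: 'm
  assumes "skew_symmetric_algebroid A"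
    and "pseudo_riemannian_metric A g"
    and "connection A nab"
    and "X \<in> sections A" "Y \<in> sections A" "Z \<in> sections A"
  shows "g p (sym_bracket nab X Y p) (Z p) =
           g p (sharp A g (\<lambda>W q. lie_alt A X (flat g Y) W q + lie_alt A Y (flat g X) W q
                                 - d_alt A (\<lambda>r. g r (X r) (Y r)) W q) p) (Z p)
           - g p (torsion A nab X Z p) (Y p)
           - g p (torsion A nab Y Z p) (X p)
           + 2 * cov_diff A nab (metric_tensor g) [Z, X, Y] p
           - sym_cov_diff A nab (metric_tensor g) [X, Y, Z] p"
proof -
  note vb = algebroid_bundle[OF assms(1)]
  note F = bundle_fibre[OF vb, of p]
  let ?\<omega> = "\<lambda>W q. lie_alt A X (flat g Y) W q + lie_alt A Y (flat g X) W q
      - d_alt A (\<lambda>r. g r (X r) (Y r)) W q"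
  have "smooth_one_form A ?\<omega>"
    by (intro smooth_one_form_diff smooth_one_form_add smooth_one_form_lie_alt smooth_one_form_d_alt
        smooth_one_form_flat metric_smooth assms vb)
  from metric_sharp[OF vb assms(2) this assms(6)]
  have sharp: "g p (sharp A g ?\<omega> p) (Z p) =
      anchor_act A X (\<lambda>q. g q (Y q) (Z q)) p - g p (Y p) (bracket A X Z p)
      + (anchor_act A Y (\<lambda>q. g q (X q) (Z q)) p - g p (X p) (bracket A Y Z p))
      - anchor_act A Z (\<lambda>q. g q (X q) (Y q)) p"
    by (simp add: lie_alt_def d_alt_def flat_def)
  note nabla = connection_section[OF assms(3), THEN sections_fibre, of _ _ p]
    and br = bracket_section[OF assms(1), THEN sections_fibre, of _ _ p]
    and pt = sections_fibre[of _ A p]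
  have bracket: "g p (sym_bracket nab X Y p) (Z p) = g p (nab X Y p) (Z p) + g p (nab Y X p) (Z p)"
    unfolding sym_bracket_def
    by (rule lin_on_add[OF metric_left[OF vb assms(2)]]) (intro pt nabla assms)+
  have torsion: "g p (torsion A nab V Z p) (W p) =
      g p (W p) (nab V Z p) - g p (nab Z V p) (W p) - g p (W p) (bracket A V Z p)"
    if "V \<in> sections A" "W \<in> sections A" for V W
    using that assms(6)
    by (simp add: torsion_def lin_on_diff[OF metric_left[OF vb assms(2)] F] nabla br pt
        subspace_diff[OF F] metric_sym[OF assms(2), of "W p"] assms(1))
  show ?thesis
    \<comment> \<open>All derivatives of functions, all brackets and all terms with \<open>\<nabla>\<^sub>X Z\<close>, \<open>\<nabla>\<^sub>Y Z\<close>, \<open>\<nabla>\<^sub>Z X\<close>,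
    \<open>\<nabla>\<^sub>Z Y\<close> cancel; symmetry of \<open>g\<close> brings equal terms into the same form.\<close>
    unfolding bracket sharp torsion[OF assms(4,5)] torsion[OF assms(5,4)]
    using metric_sym[OF assms(2) pt[OF assms(4)] nabla[OF assms(6,5)]]
      metric_sym[OF assms(2) pt[OF assms(5)] nabla[OF assms(4,6)]]
      metric_sym[OF assms(2) pt[OF assms(4)] nabla[OF assms(5,6)]]
    by (simp add: cov_diff_def sym_cov_diff_def cov_deriv_metric numeral_3_eq_3)
qed

end
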